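(* Let $r \geqslant 2$ be an integer, and let $p = x n^{-2/(r+1)}$, where $x = x(n) \to \infty$ as $n \to \infty$. If $t = t(n) \geqslant p^{-(r+1)/2} \log x$, then $$G(rn + t, p) \to (K_{r+1}, P_n)$$ with high probability as $n \to \infty$.
   Context: $G(N,p)$ denotes the Erdős–Rényi random graph on $N$ vertices in which each pair is an edge independently with probability $p$. $P_n$ is the path with $n$ edges, and $K_{r+1}$ is the complete graph on $r+1$ vertices. For graphs $G, H_1, H_2$, we write $G \to (H_1,H_2)$ if every red-blue colouring of the edges of $G$ contains either a red copy of $H_1$ or a blue copy of $H_2$. "With high probability" means with probability tending to $1$ as $n \to \infty$. *)

theory Defs
  imports "HOL-Probability.Probability"
begin

text \<open>
  A finite simple graph is given by its vertex set and its set of edges, each edge being a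
  two-element set of vertices.
\<close>

type_synonym 'a graph = "'a set \<times> 'a set set"

abbreviation verts :: "'a graph \<Rightarrow> 'a set" where
  "verts G \<equiv> fst G"

abbreviation edges :: "'a graph \<Rightarrow> 'a set set" where
  "edges G \<equiv> snd G"

definition all_pairs :: "'a set \<Rightarrow> 'a set set" where
  "all_pairs V = {e. e \<subseteq> V \<and> card e = 2}"

definition complete_graph :: "nat \<Rightarrow> nat graph" where
  "complete_graph m = ({..<m}, all_pairs {..<m})"

text \<open>The path is indexed by its number of edges, so it has \<open>n + 1\<close> vertices.\<close>

definition path_graph :: "nat \<Rightarrow> nat graph" where
  "path_graph n = ({..n}, {{i, Suc i} | i. i < n})"

text \<open>Copies are subgraphs, not necessarily induced.\<close>

definition contains_copy :: "'a graph \<Rightarrow> 'b graph \<Rightarrow> bool" where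
  "contains_copy G H \<longleftrightarrow>
     (\<exists>f. inj_on f (verts H) \<and> f ` verts H \<subseteq> verts G \<and> (\<forall>e\<in>edges H. f ` e \<in> edges G))"

datatype colour = Red | Blue

definition colour_class :: "'a graph \<Rightarrow> ('a set \<Rightarrow> colour) \<Rightarrow> colour \<Rightarrow> 'a graph" where
  "colour_class G c k = (verts G, {e \<in> edges G. c e = k})"

text \<open>
  The relation \<open>G \<rightarrow> (H1, H2)\<close>. A colouring is a total function, but only its values on the edges
  of \<open>G\<close> matter.
\<close>

definition arrows :: "'a graph \<Rightarrow> 'b graph \<Rightarrow> 'c graph \<Rightarrow> bool" where
  "arrows G H1 H2 \<longleftrightarrow>
     (\<forall>c. contains_copy (colour_class G c Red) H1 \<or> contains_copy (colour_class G c Blue) H2)"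

text \<open>
  The Erdos--Renyi random graph on the vertex set \<open>{..<N}\<close>: one independent Bernoulli variable
  per pair of vertices. Only meaningful for \<open>0 \<le> p \<le> 1\<close>, since \<^const>\<open>bernoulli_pmf\<close> truncates
  its parameter to the unit interval.
\<close>

definition random_graph :: "nat \<Rightarrow> real \<Rightarrow> nat graph pmf" where
  "random_graph N p =
     map_pmf (\<lambda>b. ({..<N}, {e \<in> all_pairs {..<N}. b e}))
       (Pi_pmf (all_pairs {..<N}) False (\<lambda>_. bernoulli_pmf p))"

end

theory Submission
  imports Defs "HOL-Real_Asymp.Real_Asymp"
begin

text \<open>
  Colour \<open>V\<close>, where \<open>card V = r n + t\<close>, without a blue \<open>P\<^sub>n\<close>.  Running depth-first search on the blue
  graph \<open>r\<close> times, each time stopping when \<open>s\<close> vertices are finished and continuing inside the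
  unvisited vertices, leaves \<open>r + 1\<close> disjoint sets with no blue edges in between: \<open>r\<close> of size \<open>s\<close>, and
  the rest of \<open>V\<close> except for the \<open>r\<close> stacks, which are blue paths and so have at most \<open>n\<close> vertices
  each.  A copy of \<open>K\<^sub>r\<^sub>+\<^sub>1\<close> in \<open>G\<close> meeting each of these sets once is red.

  If \<open>p \<le> n powr - \<epsilon>\<close>, take \<open>s = t div (r + 1)\<close>, so that all \<open>r + 1\<close> sets have size at least \<open>s\<close>.
  Janson's inequality and a union bound over all families of disjoint \<open>s\<close>-sets give the transversal
  clique.  The bound beats the number of families because \<open>(ln x) ^ r\<close> dominates \<open>ln x\<close> for \<open>r \<ge> 2\<close>.

  For larger \<open>p\<close> (in particular constant \<open>p\<close>) \<open>t\<close> may be too small for this.  With \<open>s\<close> of order \<open>sqrt n\<close>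
  transversal cliques still exist, so the stacks are \<open>r\<close> blue paths covering all but \<open>O(sqrt n)\<close>
  vertices.  Edges between the beginnings of the paths must be red, for a blue one would give a
  longer path.  Each leftover vertex, apart from \<open>O(1 / p)\<close> exceptional ones with low degree to the
  beginning of some path, has many blue neighbours on some path, since otherwise it would complete a
  red clique.  As \<open>t\<close> exceeds the number of exceptional vertices, one of the paths together with the
  leftover vertices attached to it has more than \<open>n\<close> vertices, and absorbing these one by one into
  the path yields a blue \<open>P\<^sub>n\<close>.
\<close>

section \<open>Depth-first search and blue paths\<close>

definition transversal_clique ::
    "nat \<Rightarrow> (nat \<Rightarrow> 'a set) \<Rightarrow> ('a \<Rightarrow> 'a \<Rightarrow> bool) \<Rightarrow> bool" where
  "transversal_clique k S adj \<longleftrightarrow>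
     (\<exists>f. (\<forall>i<k. f i \<in> S i) \<and> (\<forall>i<k. \<forall>j<k. i \<noteq> j \<longrightarrow> adj (f i) (f j)))"

text \<open>Sizes are exactly \<open>s\<close>, so that a union bound over \<open>s\<close>-subsets
  applies; larger sets are handled by shrinking them in
  \<open>blue_free_transversal\<close>.\<close>

definition has_transversals :: "nat \<Rightarrow> nat \<Rightarrow> 'a set \<Rightarrow> ('a \<Rightarrow> 'a \<Rightarrow> bool) \<Rightarrow> bool" where
  "has_transversals k s V adj \<longleftrightarrow>
     (\<forall>S. (\<forall>i<k. S i \<subseteq> V \<and> card (S i) = s) \<and> disjoint_family_on S {..<k} \<longrightarrow>
        transversal_clique k S adj)"

text \<open>One run of the search as a changing state: \<open>D\<close> finished, \<open>P\<close>
  the stack with its top at the head, \<open>U\<close> unvisited. Each move pushes an unvisited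
  neighbour of the top, starts a new stack, or pops a top without unvisited neighbours into
  \<open>D\<close>, which keeps \<open>D\<close> and \<open>U\<close> unrelated. At most one vertex
  finishes per move, so the size \<open>s\<close> is hit exactly.\<close>

lemma dfs_advance:
  fixes B :: "'a \<Rightarrow> 'a \<Rightarrow> bool"
  assumes "symp B"
  shows "\<lbrakk>finite D; finite U; D \<inter> U = {}; D \<inter> set P = {}; set P \<inter> U = {}; distinct P;
     successively B P; \<forall>a\<in>D. \<forall>u\<in>U. \<not> B a u; D \<union> set P \<union> U = V;
     card D \<le> s; s \<le> card V\<rbrakk> \<Longrightarrow>
     \<exists>D' P' U'. D' \<union> set P' \<union> U' = V \<and> D' \<inter> U' = {} \<and> D' \<inter> set P' = {} \<and>
       set P' \<inter> U' = {} \<and> distinct P' \<and> successively B P' \<and>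
       (\<forall>a\<in>D'. \<forall>u\<in>U'. \<not> B a u) \<and> card D' = s"
\<comment> \<open>The weight 2 pays for a push, which shrinks \<open>U\<close> and lengthens
  \<open>P\<close> by one each.\<close>
proof (induction "2 * card U + length P" arbitrary: D P U rule: less_induct)
  case less
  note pr = less.prems
  show ?case
  proof (cases "card D = s")
    case True
    with pr show ?thesis by blast
  next
    case False
    with pr have lt: "card D < s" by simp
    show ?thesis
    proof (cases P)
      case Nil
      have "U \<noteq> {}" using lt pr(9,11) Nil by auto
      then obtain u where u: "u \<in> U" by blast
      have c: "card (U - {u}) < card U" using u pr(2) by (meson card_Diff1_less)
      show ?thesis
      proof (rule less.hyps)
        show "2 * card (U - {u}) + length [u] < 2 * card U + length P" using c by simp
        show "D \<union> set [u] \<union> (U - {u}) = V" using u Nil pr(9) by auto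
        show "D \<inter> set [u] = {}" using u pr(3) by auto
      qed (use pr(1-3,8,10,11) in auto)
    next
      case (Cons v vs)
      show ?thesis
      proof (cases "\<exists>u\<in>U. B v u")
        case True
        then obtain u where u: "u \<in> U" "B v u" by blast
        have c: "card (U - {u}) < card U" using u pr(2) by (meson card_Diff1_less)
        have uv: "B u v" using u assms by (meson sympD)
        show ?thesis
        proof (rule less.hyps)
          show "2 * card (U - {u}) + length (u # P) < 2 * card U + length P" using c by simp
          show "D \<union> set (u # P) \<union> (U - {u}) = V" using u pr(9) by auto
          show "distinct (u # P)" using pr(5,6) u by auto
          show "successively B (u # P)" using pr(7) Cons uv by simp
          show "D \<inter> set (u # P) = {}" using u pr(3,4) by auto
          show "set (u # P) \<inter> (U - {u}) = {}" using pr(5) by auto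
        qed (use pr(1-3,8,10,11) in auto)
      next
        case False
        show ?thesis
        proof (rule less.hyps)
          show "2 * card U + length vs < 2 * card U + length P" using Cons by simp
          show "insert v D \<union> set vs \<union> U = V" using Cons pr(9) by auto
          show "card (insert v D) \<le> s" using lt pr(1) by (simp add: card_insert_if)
          show "successively B vs" using pr(7) Cons by (cases vs) auto
          show "distinct vs" using pr(6) Cons by auto
          show "insert v D \<inter> U = {}" "set vs \<inter> U = {}" using pr(3,5) Cons by auto
          show "insert v D \<inter> set vs = {}" using pr(4,6) Cons by auto
          show "\<forall>a\<in>insert v D. \<forall>u\<in>U. \<not> B a u" using pr(8) False by blast
        qed (use pr(1,2,11) in auto)
      qed
    qed
  qed
qed

lemma dfs_split:
  fixes B :: "'a \<Rightarrow> 'a \<Rightarrow> bool"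
  assumes "symp B" "finite V" "s \<le> card V"
  obtains D P U where "D \<union> set P \<union> U = V" "D \<inter> U = {}" "D \<inter> set P = {}" "set P \<inter> U = {}"
    "distinct P" "successively B P" "\<And>a u. a \<in> D \<Longrightarrow> u \<in> U \<Longrightarrow> \<not> B a u" "card D = s"
  using dfs_advance[OF assms(1), of "{}" V "[]" V s] assms by (auto simp: that)

text \<open>A rotation: cut \<open>R\<close> after positions \<open>i\<close> and \<open>j\<close>,
  reverse the middle piece and insert \<open>y\<close> in front of it. The three edges in the
  assumptions bridge the new joints.\<close>

lemma successively_insert_vertex:
  assumes "symp B" "successively B R" "i < j" "Suc j < length R"
    and "B (R ! i) y" "B y (R ! j)" "B (R ! Suc i) (R ! Suc j)"
  obtains R' where "successively B R'" "mset R' = add_mset y (mset R)"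
proof -
  define A M D where "A = take (Suc i) R" and "M = take (j - i) (drop (Suc i) R)"
    and "D = drop (Suc j) R"
  have "drop (Suc i) R = M @ D"
    using assms(3) append_take_drop_id[of "j - i" "drop (Suc i) R"] by (simp add: M_def D_def)
  then have R: "R = A @ M @ D" unfolding A_def by (metis append_take_drop_id)
  have lens: "length A = Suc i" "length M = j - i" "D \<noteq> []"
    using assms by (auto simp: A_def M_def D_def)
  then have ne: "A \<noteq> []" "M \<noteq> []" "D \<noteq> []" using assms(3) by auto
  have vals: "last A = R ! i" "hd M = R ! Suc i" "last M = R ! j" "hd D = R ! Suc j"
    using ne lens assms(3,4)
    by (auto simp: last_conv_nth hd_conv_nth A_def M_def D_def)
  have sy: "B x y \<longleftrightarrow> B y x" for x y using assms(1) by (meson sympD)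
  have "successively B A" "successively B M" "successively B D"
    using assms(2) unfolding R by (auto simp: successively_append_iff)
  moreover from this have "successively B (rev M)"
    by (simp add: sy)
  ultimately have "successively B (A @ y # rev M @ D)"
    using ne vals assms(5-7) by (auto simp: successively_append_iff successively_Cons hd_rev last_rev)
  moreover have "mset (A @ y # rev M @ D) = add_mset y (mset R)" unfolding R by simp
  ultimately show thesis by (rule that)
qed

text \<open>Each round searches inside the last set and replaces it by the finished and the
  unvisited vertices. The first \<open>r - 1\<close> rounds use up at most \<open>s + n\<close>
  vertices each and the last one needs \<open>s\<close> to begin with; the size hypothesis says this
  with \<open>n\<close> moved across, which avoids subtraction.\<close>

lemma dfs_iterate:
  fixes B :: "'a \<Rightarrow> 'a \<Rightarrow> bool"
  assumes "symp B" "finite V"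
    and short: "\<forall>xs. set xs \<subseteq> V \<and> distinct xs \<and> successively B xs \<longrightarrow> length xs \<le> n"
    and "r * (s + n) \<le> card V + n"
  shows "\<exists>S Q. (\<Union>i\<le>r. S i) \<union> (\<Union>i<r. set (Q i)) = V \<and>
     (\<forall>i<r. card (S i) = s \<and> distinct (Q i) \<and> successively B (Q i)) \<and>
     (\<forall>i\<le>r. \<forall>j\<le>r. i \<noteq> j \<longrightarrow> S i \<inter> S j = {} \<and> (\<forall>u\<in>S i. \<forall>v\<in>S j. \<not> B u v)) \<and>
     (\<forall>i<r. \<forall>j<r. i \<noteq> j \<longrightarrow> set (Q i) \<inter> set (Q j) = {}) \<and>
     (\<forall>i\<le>r. \<forall>j<r. S i \<inter> set (Q j) = {}) \<and>
     card V = r * s + (\<Sum>i<r. length (Q i)) + card (S r)"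
  using assms(4)
proof (induction r)
  case 0
  show ?case by (rule exI[of _ "\<lambda>_. V"]) auto
next
  case (Suc r)
  have "r * (s + n) \<le> card V + n" using Suc.prems by simp
  from Suc.IH[OF this] obtain S Q where
    V: "(\<Union>i\<le>r. S i) \<union> (\<Union>i<r. set (Q i)) = V"
    and a: "\<forall>i<r. card (S i) = s \<and> distinct (Q i) \<and> successively B (Q i)"
    and b: "\<forall>i\<le>r. \<forall>j\<le>r. i \<noteq> j \<longrightarrow> S i \<inter> S j = {} \<and> (\<forall>u\<in>S i. \<forall>v\<in>S j. \<not> B u v)"
    and c: "\<forall>i<r. \<forall>j<r. i \<noteq> j \<longrightarrow> set (Q i) \<inter> set (Q j) = {}"
    and d: "\<forall>i\<le>r. \<forall>j<r. S i \<inter> set (Q j) = {}"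
    and e: "card V = r * s + (\<Sum>i<r. length (Q i)) + card (S r)"
    by (elim exE conjE)
  have "length (Q i) \<le> n" if "i < r" for i
  proof -
    have "set (Q i) \<subseteq> V" using that unfolding V[symmetric] by blast
    then show ?thesis using short a that by simp
  qed
  then have "(\<Sum>i<r. length (Q i)) \<le> r * n"
    using sum_bounded_above[of "{..<r}" "\<lambda>i. length (Q i)" n] by simp
  then have "s \<le> card (S r)" using e Suc.prems by (simp add: algebra_simps)
  moreover have sub: "S r \<subseteq> V" using V by auto
  moreover from this have fin: "finite (S r)" using assms(2) by (rule finite_subset)
  ultimately obtain D P U where D: "D \<union> set P \<union> U = S r" "D \<inter> U = {}" "D \<inter> set P = {}" "set P \<inter> U = {}"
    "distinct P" "successively B P" "\<And>a u. a \<in> D \<Longrightarrow> u \<in> U \<Longrightarrow> \<not> B a u" "card D = s"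
    using dfs_split[OF assms(1)] by metis
  have sy: "B x y \<longleftrightarrow> B y x" for x y using assms(1) by (meson sympD)
  define S' where "S' = S(r := D, Suc r := U)"
  define Q' where "Q' = Q(r := P)"
  \<comment> \<open>The new sets with indices \<open>r\<close> and \<open>Suc r\<close> both lie
    inside the old \<open>S r\<close>, so every pair except this one inherits disjointness and
    separation.\<close>
  have S'S: "S' i \<subseteq> S (min i r)" if "i \<le> Suc r" for i
    using that D(1) by (auto simp: S'_def min_def)
  have S'1: "S' i = S i" if "i < r" for i using that by (simp add: S'_def)
  have S'2: "S' r = D" "S' (Suc r) = U" by (simp_all add: S'_def)
  have Q'1: "Q' i = Q i" if "i < r" for i using that by (simp add: Q'_def)
  have Q'2: "Q' r = P" by (simp add: Q'_def)
  show ?case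
  proof (intro exI[of _ S'] exI[of _ Q'] conjI)
    have at: "{..r} = insert r {..<r}" by auto
    have "(\<Union>i\<le>Suc r. S' i) \<union> (\<Union>i<Suc r. set (Q' i)) =
       (\<Union>i<r. S' i) \<union> S' r \<union> S' (Suc r) \<union> (\<Union>i<r. set (Q' i)) \<union> set (Q' r)"
      unfolding atMost_Suc lessThan_Suc at by auto
    also have "\<dots> = (\<Union>i<r. S i) \<union> (D \<union> set P \<union> U) \<union> (\<Union>i<r. set (Q i))"
      using S'1 S'2 Q'1 Q'2 by auto
    also have "\<dots> = V" unfolding D(1) V[symmetric] at by auto
    finally show "(\<Union>i\<le>Suc r. S' i) \<union> (\<Union>i<Suc r. set (Q' i)) = V" .
    show "\<forall>i<Suc r. card (S' i) = s \<and> distinct (Q' i) \<and> successively B (Q' i)"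
      using a D S'1 S'2 Q'1 Q'2 by (auto simp: less_Suc_eq)
    show "\<forall>i\<le>Suc r. \<forall>j\<le>Suc r. i \<noteq> j \<longrightarrow> S' i \<inter> S' j = {} \<and> (\<forall>u\<in>S' i. \<forall>v\<in>S' j. \<not> B u v)"
    proof (intro allI impI)
      fix i j assume ij: "i \<le> Suc r" "j \<le> Suc r" "i \<noteq> j"
      show "S' i \<inter> S' j = {} \<and> (\<forall>u\<in>S' i. \<forall>v\<in>S' j. \<not> B u v)"
      proof (cases "min i r = min j r")
        case False
        then have "S (min i r) \<inter> S (min j r) = {} \<and> (\<forall>u\<in>S (min i r). \<forall>v\<in>S (min j r). \<not> B u v)"
          using b[rule_format, of "min i r" "min j r"] by auto
        then show ?thesis using S'S[OF ij(1)] S'S[OF ij(2)] by blast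
      next
        case True
        then have "i = r \<and> j = Suc r \<or> j = r \<and> i = Suc r"
          using ij by (auto simp: min_def split: if_splits)
        moreover have "\<forall>a\<in>D. \<forall>u\<in>U. \<not> B a u \<and> \<not> B u a" using D(7) sy by blast
        ultimately show ?thesis using D(2) S'2 by blast
      qed
    qed
    have PS: "set P \<subseteq> S r" using D(1) by auto
    show "\<forall>i<Suc r. \<forall>j<Suc r. i \<noteq> j \<longrightarrow> set (Q' i) \<inter> set (Q' j) = {}"
    proof (intro allI impI)
      have *: "set (Q j) \<inter> set P = {}" if "j < r" for j using PS d that by blast
      fix i j assume "i < Suc r" "j < Suc r" "i \<noteq> j"
      then consider "i < r" "j < r" "i \<noteq> j" | "i = r" "j < r" | "i < r" "j = r" by linarith
      then show "set (Q' i) \<inter> set (Q' j) = {}"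
        by cases (use c * Q'1 Q'2 in \<open>auto simp: Int_commute\<close>)
    qed
    show "\<forall>i\<le>Suc r. \<forall>j<Suc r. S' i \<inter> set (Q' j) = {}"
    proof (intro allI impI)
      fix i j assume ij: "i \<le> Suc r" "j < Suc r"
      show "S' i \<inter> set (Q' j) = {}"
      proof (cases "j < r")
        case True
        then have "S (min i r) \<inter> set (Q j) = {}" using d by simp
        then show ?thesis using S'S[OF ij(1)] Q'1[OF True] by auto
      next
        case False
        then have j: "j = r" using ij by simp
        show ?thesis
        proof (cases "i < r")
          case True
          then have "S i \<inter> S r = {}" using b by simp
          then show ?thesis using PS j Q'2 S'1[OF True] by auto
        next
          case False
          then have "i = r \<or> i = Suc r" using ij by auto
          then show ?thesis using D(3,4) j S'2 Q'2 by auto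
        qed
      qed
    qed
    have "finite D" "finite U" using fin D(1) by (auto intro: finite_subset)
    then have "card (S r) = card D + card (set P) + card U"
      using D(2-4) unfolding D(1)[symmetric]
      by (subst card_Un_disjoint; (subst card_Un_disjoint)?; auto)
    then have "card (S r) = s + length P + card U" using D(5,8) by (simp add: distinct_card)
    then show "card V = Suc r * s + (\<Sum>i<Suc r. length (Q' i)) + card (S' (Suc r))"
      using e Q'1 Q'2 S'2 by simp
  qed
qed

section \<open>Two-coloured graphs without a long blue path and a red clique\<close>

text \<open>A colouring that defeats the arrow relation, restricted to \<open>V\<close>.
  \<open>short\<close> counts vertices, so the bound \<open>n\<close> excludes paths with
  \<open>n\<close> edges. In the application red pairs consist of distinct vertices, which makes the
  \<open>f\<close> of \<open>no_clique\<close> injective.\<close>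

locale two_coloured =
  fixes V :: "'a set" and red blue :: "'a \<Rightarrow> 'a \<Rightarrow> bool" and n r :: nat
  assumes fin: "finite V"
    and sym_red: "symp red" and sym_blue: "symp blue"
    and short: "\<And>xs. set xs \<subseteq> V \<Longrightarrow> distinct xs \<Longrightarrow> successively blue xs \<Longrightarrow> length xs \<le> n"
    and no_clique: "\<And>f. (\<And>i. i < Suc r \<Longrightarrow> f i \<in> V) \<Longrightarrow>
      (\<And>i j. i < Suc r \<Longrightarrow> j < Suc r \<Longrightarrow> i \<noteq> j \<Longrightarrow> red (f i) (f j)) \<Longrightarrow> False"
begin

definition adj :: "'a \<Rightarrow> 'a \<Rightarrow> bool" where "adj u v \<longleftrightarrow> red u v \<or> blue u v"

lemma red_commute: "red u v \<longleftrightarrow> red v u" using sym_red by (meson sympD)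

lemma blue_commute: "blue u v \<longleftrightarrow> blue v u" using sym_blue by (meson sympD)

lemma blue_free_transversal:
  assumes "has_transversals k s V adj"
    and "\<And>i. i < k \<Longrightarrow> S i \<subseteq> V" "\<And>i. i < k \<Longrightarrow> s \<le> card (S i)"
    and "\<And>i j. i < k \<Longrightarrow> j < k \<Longrightarrow> i \<noteq> j \<Longrightarrow> S i \<inter> S j = {}"
  obtains f where "\<And>i. i < k \<Longrightarrow> f i \<in> S i"
    "\<And>i j. i < k \<Longrightarrow> j < k \<Longrightarrow> i \<noteq> j \<Longrightarrow> \<not> blue (f i) (f j) \<Longrightarrow> red (f i) (f j)"
proof -
  have "\<exists>X. X \<subseteq> S i \<and> card X = s" if "i < k" for i
    by (rule obtain_subset_with_card_n[OF assms(3)[OF that]]) blast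
  then obtain T where T: "\<And>i. i < k \<Longrightarrow> T i \<subseteq> S i \<and> card (T i) = s" by metis
  have "\<forall>i<k. T i \<subseteq> V \<and> card (T i) = s" using T assms(2) by blast
  moreover have "disjoint_family_on T {..<k}"
    unfolding disjoint_family_on_def
  proof (intro ballI impI)
    fix i j assume "i \<in> {..<k}" "j \<in> {..<k}" "i \<noteq> j"
    then show "T i \<inter> T j = {}" using T[of i] T[of j] assms(4)[of i j] by auto
  qed
  ultimately obtain f where f: "\<forall>i<k. f i \<in> T i" "\<forall>i<k. \<forall>j<k. i \<noteq> j \<longrightarrow> adj (f i) (f j)"
    using assms(1) unfolding has_transversals_def transversal_clique_def by metis
  show thesis
  proof (rule that)
    show "f i \<in> S i" if "i < k" for i using f(1)[rule_format, OF that] T[OF that] by blast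
    show "red (f i) (f j)" if "i < k" "j < k" "i \<noteq> j" "\<not> blue (f i) (f j)" for i j
      using f(2)[rule_format, OF that(1-3)] that(4) unfolding adj_def by simp
  qed
qed

text \<open>With no blue edges between the sets, their transversal clique is entirely red, against
  \<open>no_clique\<close>.\<close>

lemma blue_between:
  assumes "has_transversals (Suc r) s V adj"
    and "\<And>i. i < Suc r \<Longrightarrow> S i \<subseteq> V" "\<And>i. i < Suc r \<Longrightarrow> s \<le> card (S i)"
    and "\<And>i j. i < Suc r \<Longrightarrow> j < Suc r \<Longrightarrow> i \<noteq> j \<Longrightarrow> S i \<inter> S j = {}"
    and "\<And>i j u v. i < Suc r \<Longrightarrow> j < Suc r \<Longrightarrow> i \<noteq> j \<Longrightarrow> u \<in> S i \<Longrightarrow> v \<in> S j \<Longrightarrow> \<not> blue u v"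
  shows False
proof -
  obtain f where f: "\<And>i. i < Suc r \<Longrightarrow> f i \<in> S i"
    "\<And>i j. i < Suc r \<Longrightarrow> j < Suc r \<Longrightarrow> i \<noteq> j \<Longrightarrow> \<not> blue (f i) (f j) \<Longrightarrow> red (f i) (f j)"
    using blue_free_transversal[of "Suc r" s S] assms(1-4) by metis
  show False
  proof (rule no_clique)
    show "f i \<in> V" if "i < Suc r" for i using f(1)[OF that] assms(2)[OF that] by blast
    show "red (f i) (f j)" if "i < Suc r" "j < Suc r" "i \<noteq> j" for i j
      by (rule f(2)[OF that]) (rule assms(5)[OF that f(1)[OF that(1)] f(1)[OF that(2)]])
  qed
qed

text \<open>Were the last set of the iterated search as large as \<open>s\<close>, its
  \<open>Suc r\<close> sets would contradict \<open>blue_between\<close>. Hence these sets form a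
  small leftover \<open>W\<close>, and the stacks cover the rest.\<close>

lemma path_cover:
  assumes "has_transversals (Suc r) s V adj" "r * (s + n) \<le> card V + n"
  obtains Q W where "\<And>i. i < r \<Longrightarrow> distinct (Q i)" "\<And>i. i < r \<Longrightarrow> successively blue (Q i)"
    "\<And>i j. i < r \<Longrightarrow> j < r \<Longrightarrow> i \<noteq> j \<Longrightarrow> set (Q i) \<inter> set (Q j) = {}"
    "\<And>i. i < r \<Longrightarrow> set (Q i) \<inter> W = {}"
    "(\<Union>i<r. set (Q i)) \<union> W = V" "card W < Suc r * s"
    "card V < (\<Sum>i<r. length (Q i)) + Suc r * s"
proof -
  have "\<forall>xs. set xs \<subseteq> V \<and> distinct xs \<and> successively blue xs \<longrightarrow> length xs \<le> n"
    using short by blast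
  from dfs_iterate[OF sym_blue fin this assms(2)] obtain S Q where
    V: "(\<Union>i\<le>r. S i) \<union> (\<Union>i<r. set (Q i)) = V"
    and a: "\<forall>i<r. card (S i) = s \<and> distinct (Q i) \<and> successively blue (Q i)"
    and b: "\<forall>i\<le>r. \<forall>j\<le>r. i \<noteq> j \<longrightarrow> S i \<inter> S j = {} \<and> (\<forall>u\<in>S i. \<forall>v\<in>S j. \<not> blue u v)"
    and c: "\<forall>i<r. \<forall>j<r. i \<noteq> j \<longrightarrow> set (Q i) \<inter> set (Q j) = {}"
    and d: "\<forall>i\<le>r. \<forall>j<r. S i \<inter> set (Q j) = {}"
    and e: "card V = r * s + (\<Sum>i<r. length (Q i)) + card (S r)"
    by (elim exE conjE)
  have lt: "card (S r) < s"
  proof (rule ccontr)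
    assume "\<not> card (S r) < s"
    then have "s \<le> card (S i)" if "i < Suc r" for i using a that by (cases "i = r") auto
    then show False
      by (intro blue_between[OF assms(1), of S]) (use V b in \<open>auto simp: less_Suc_eq_le\<close>)
  qed
  define W where "W = (\<Union>i\<le>r. S i)"
  have at: "{..r} = insert r {..<r}" by auto
  have "card W \<le> card (\<Union>i<r. S i) + card (S r)"
    unfolding W_def at by (simp add: card_Un_le Un_commute[of "S r"])
  also have "card (\<Union>i<r. S i) \<le> (\<Sum>i<r. card (S i))" by (rule card_UN_le) simp
  also have "\<dots> = r * s" using a by simp
  finally have "card W < Suc r * s" using lt by simp
  then show thesis
  proof (rule that[rotated 5])
    show "set (Q i) \<inter> W = {}" if "i < r" for i
      using d that unfolding W_def by blast
    show "card V < (\<Sum>i<r. length (Q i)) + Suc r * s" using e lt by simp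
    show "(\<Union>i<r. set (Q i)) \<union> W = V" using V unfolding W_def by blast
  qed (use a c in simp_all)
qed

text \<open>The stacks hold at most \<open>r * n\<close> vertices in total, yet they miss fewer than
  \<open>Suc r * s\<close> vertices, which is at most \<open>t\<close>.\<close>

lemma contradiction_sparse:
  assumes "has_transversals (Suc r) s V adj" "Suc r * s \<le> t" "card V = r * n + t"
  shows False
proof -
  have "r * (s + n) \<le> card V + n" using assms(2,3) by (simp add: algebra_simps)
  from assms(1) this obtain Q W where Q:
    "\<And>i. i < r \<Longrightarrow> distinct (Q i)" "\<And>i. i < r \<Longrightarrow> successively blue (Q i)"
    "(\<Union>i<r. set (Q i)) \<union> W = V" "card V < (\<Sum>i<r. length (Q i)) + Suc r * s"
    by (rule path_cover) (rule that)
  have "length (Q i) \<le> n" if "i < r" for i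
  proof (rule short)
    show "set (Q i) \<subseteq> V" using that unfolding Q(3)[symmetric] by blast
  qed (use Q that in simp_all)
  then have "(\<Sum>i<r. length (Q i)) \<le> r * n"
    using sum_bounded_above[of "{..<r}" "\<lambda>i. length (Q i)" n] by simp
  then show False using Q(4) assms by linarith
qed

text \<open>\<open>m\<close> is the transversal size, \<open>k\<close> bounds the exceptional
  vertices per path, and \<open>D\<close> is the degree into the first quarter of a path. The bound
  on \<open>D\<close> allows for \<open>m\<close> red neighbours, fewer than
  \<open>Suc r * m\<close> leftover vertices and one path end, and still leaves \<open>2 * m\<close>
  successors at the end of the proof.\<close>

lemma contradiction_dense:
  assumes TC: "has_transversals (Suc r) m V adj"
    and V: "card V = r * n + t" "r * k < t" "0 < r"
    and deg: "\<And>Q E. Q \<subseteq> V \<Longrightarrow> E \<subseteq> V \<Longrightarrow> Q \<inter> E = {} \<Longrightarrow> card Q = n div 4 \<Longrightarrow> card E = k \<Longrightarrow>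
      \<exists>v\<in>E. D \<le> card {q \<in> Q. adj v q}"
    and D: "(r + 4) * m + 1 \<le> D" and n: "8 * (Suc r * m) \<le> n"
  shows False
proof -
  have "r * (m + n) \<le> card V + n" using V(1) n by (simp add: algebra_simps)
  from TC this obtain Q W where Q:
    "\<And>i. i < r \<Longrightarrow> distinct (Q i)" "\<And>i. i < r \<Longrightarrow> successively blue (Q i)"
    "\<And>i j. i < r \<Longrightarrow> j < r \<Longrightarrow> i \<noteq> j \<Longrightarrow> set (Q i) \<inter> set (Q j) = {}"
    "\<And>i. i < r \<Longrightarrow> set (Q i) \<inter> W = {}"
    and QW: "(\<Union>i<r. set (Q i)) \<union> W = V" and cW: "card W < Suc r * m"
    and cV: "card V < (\<Sum>i<r. length (Q i)) + Suc r * m"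
    by (rule path_cover) (rule that)
  have QV: "set (Q i) \<subseteq> V" if "i < r" for i using that unfolding QW[symmetric] by blast
  have WV: "W \<subseteq> V" using QW by blast
  have finW: "finite W" using WV fin by (rule finite_subset)
  have Qn: "length (Q i) \<le> n" if "i < r" for i
    by (rule short) (use that Q(1,2) QV in simp_all)
  \<comment> \<open>The other \<open>r - 1\<close> paths have at most \<open>n\<close> vertices
    each, so a short path would leave too many vertices uncovered.\<close>
  have Q_long: "n < length (Q i) + Suc r * m" if i: "i < r" for i
  proof -
    have "(\<Sum>j\<in>{..<r} - {i}. length (Q j)) \<le> (r - 1) * n"
      using sum_bounded_above[of "{..<r} - {i}" "\<lambda>i. length (Q i)" n] Qn i by simp
    moreover have "(\<Sum>j<r. length (Q j)) = length (Q i) + (\<Sum>j\<in>{..<r} - {i}. length (Q j))"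
      using i by (intro sum.remove) auto
    moreover have "r * n = n + (r - 1) * n" using V(3) by (cases r) auto
    ultimately show ?thesis using cV V(1) by linarith
  qed
  define d where "d = n div 4"
  have dn: "4 * d \<le> n" "n < 4 * d + 4" by (auto simp: d_def)
  have m_le: "m \<le> Suc r * m" by simp
  have rm_eq: "(r + 4) * m = Suc r * m + 3 * m" by (simp add: algebra_simps)
  have d2m: "2 * m \<le> d" using n m_le dn by linarith
  define L where "L i = set (take d (Q i))" for i
  have LQ: "L i \<subseteq> set (Q i)" for i unfolding L_def by (rule set_take_subset)
  have cL: "card (L i) = d" if "i < r" for i
  proof -
    have "d \<le> length (Q i)" using Q_long[OF that] n dn by linarith
    then show ?thesis using Q(1)[OF that] by (simp add: L_def distinct_card)
  qed
  have LV: "L i \<subseteq> V" if "i < r" for i using LQ QV[OF that] by blast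
  have finL: "finite (L i)" for i by (simp add: L_def)
  have Ldisj: "L i \<inter> set (Q j) = {}" if "i < r" "j < r" "i \<noteq> j" for i j
    using LQ[of i] Q(3)[OF that] by blast
  \<comment> \<open>A blue edge from the first quarter of one path to another path would splice the long remainder
    of the first path with at least half of the second.\<close>
  have no_blue: "\<not> blue u v" if ij: "i < r" "j < r" "i \<noteq> j" and u: "u \<in> L i" and v: "v \<in> set (Q j)"
    for i j u v
  proof
    assume uv: "blue u v"
    obtain xs ys where xs: "take d (Q i) = xs @ u # ys" using u unfolding L_def by (metis split_list)
    define zs where "zs = ys @ drop d (Q i)"
    have Qi: "Q i = xs @ u # zs" using append_take_drop_id[of d "Q i"] xs by (simp add: zs_def)
    have "length xs < d" using arg_cong[OF xs, of length] by simp
    then have len1: "length (Q i) < length (u # zs) + d" unfolding Qi by simp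
    obtain as bs where Qj: "Q j = as @ v # bs" using v by (metis split_list)
    have s1: "successively blue (rev (u # zs))"
      using Q(2)[OF ij(1)] unfolding Qi successively_rev
      by (simp add: successively_append_iff blue_commute)
    have s2: "successively blue (v # bs)" "successively blue (rev (as @ [v]))"
      using Q(2)[OF ij(2)] unfolding Qj successively_rev
      by (auto simp: successively_append_iff blue_commute successively_Cons)
    \<comment> \<open>From \<open>v\<close> the path \<open>Q j\<close> is followed towards its
      farther end.\<close>
    define ws where "ws = (if length as \<le> length bs then v # bs else rev (as @ [v]))"
    have ws: "successively blue ws" "hd ws = v" "ws \<noteq> []" "length (Q j) < 2 * length ws"
        "distinct ws" "set ws \<subseteq> set (Q j)"
      using s2 Q(1)[OF ij(2)] by (auto simp: ws_def Qj)
    have "length (rev (u # zs) @ ws) \<le> n"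
    proof (rule short)
      show "set (rev (u # zs) @ ws) \<subseteq> V" using QV[OF ij(1)] QV[OF ij(2)] ws(6) unfolding Qi by auto
      have "set (u # zs) \<inter> set (Q j) = {}" using Q(3)[OF ij] unfolding Qi by auto
      moreover have "distinct (u # zs)" using Q(1)[OF ij(1)] unfolding Qi by auto
      ultimately show "distinct (rev (u # zs) @ ws)" using ws(5,6) by auto
      show "successively blue (rev (u # zs) @ ws)"
        using s1 ws(1-3) uv by (auto simp: successively_append_iff successively_Cons)
    qed
    then have "length (u # zs) + length ws \<le> n" by simp
    \<comment> \<open>All paths have more than \<open>7 * n / 8\<close> vertices, so the two pieces
      have more than \<open>5 * n / 8\<close> and \<open>7 * n / 16\<close>, together more than
      \<open>n\<close>.\<close>
    then show False
      using len1 ws(4) Q_long[OF ij(1)] Q_long[OF ij(2)] n dn by linarith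
  qed
  \<comment> \<open>The exceptional vertices and the vertices to be absorbed; a vertex of degree
    \<open>D\<close> with fewer than \<open>m\<close> red neighbours keeps more than
    \<open>D - m\<close> blue ones.\<close>
  define E where "E i = {w \<in> W. card {q \<in> L i. adj w q} < D}" for i
  define X where "X i = {w \<in> W. D \<le> card {q \<in> L i. blue w q} + m}" for i
  have cE: "card (E i) \<le> k" if i: "i < r" for i
  proof (rule ccontr)
    assume "\<not> card (E i) \<le> k"
    then obtain F where F: "F \<subseteq> E i" "card F = k"
      using obtain_subset_with_card_n[of k "E i"] by auto
    have "F \<subseteq> W" using F(1) by (auto simp: E_def)
    then have "F \<subseteq> V" "L i \<inter> F = {}" using WV LQ[of i] Q(4)[OF i] by blast+
    then obtain v where "v \<in> F" "D \<le> card {q \<in> L i. adj v q}"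
      using deg[OF LV[OF i]] cL[OF i] F(2) unfolding d_def by blast
    then show False using F(1) by (auto simp: E_def)
  qed
  have cover: "W \<subseteq> (\<Union>i<r. E i) \<union> (\<Union>i<r. X i)"
  proof (rule ccontr)
    assume "\<not> ?thesis"
    then obtain w where w: "w \<in> W" "\<And>i. i < r \<Longrightarrow> w \<notin> E i" "\<And>i. i < r \<Longrightarrow> w \<notin> X i" by blast
    define N where "N i = {q \<in> L i. red w q}" for i
    have cN: "m \<le> card (N i)" if "i < r" for i
    proof -
      have "D \<le> card {q \<in> L i. adj w q}" using w(1) w(2)[OF that] by (auto simp: E_def)
      also have "{q \<in> L i. adj w q} = N i \<union> {q \<in> L i. blue w q}" by (auto simp: adj_def N_def)
      also have "card \<dots> \<le> card (N i) + card {q \<in> L i. blue w q}" by (rule card_Un_le)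
      finally show ?thesis using w(1) w(3)[OF that] by (auto simp: X_def)
    qed
    obtain T where T: "T \<subseteq> N 0" "card T = m"
      using obtain_subset_with_card_n[OF cN[OF V(3)]] by auto
    \<comment> \<open>The transversal property needs \<open>Suc r\<close> sets but there are only
      \<open>r\<close> path beginnings, so \<open>L 0\<close> is split in two. The part outside
      \<open>T\<close> is a dummy whose representative is later replaced by
      \<open>w\<close>.\<close>
    define S where "S i = (if i = r then L 0 - T else if i = 0 then T else N i)" for i
    have NL: "N i \<subseteq> L i" for i by (auto simp: N_def)
    have SL: "S i \<subseteq> L i" if "i < r" for i using that T(1) NL[of i] by (auto simp: S_def)
    have Sr: "S r = L 0 - T" by (simp add: S_def)
    have S0: "S 0 = T" using V(3) by (simp add: S_def)
    have Ldisj': "L i \<inter> L j = {}" if "i < r" "j < r" "i \<noteq> j" for i j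
      using Ldisj[OF that] LQ[of j] by blast
    obtain f where f: "\<And>i. i < Suc r \<Longrightarrow> f i \<in> S i"
      "\<And>i j. i < Suc r \<Longrightarrow> j < Suc r \<Longrightarrow> i \<noteq> j \<Longrightarrow> \<not> blue (f i) (f j) \<Longrightarrow> red (f i) (f j)"
    proof (rule blue_free_transversal[OF TC, of S])
      show "S i \<subseteq> V" if "i < Suc r" for i
        using SL[of i] LV[of i] LV[OF V(3)] Sr that by (cases "i = r") auto
      show "m \<le> card (S i)" if "i < Suc r" for i
      proof (cases "i = r")
        case True
        have "finite T" using T(1) NL[of 0] finL[of 0] by (meson finite_subset)
        then have "card (L 0 - T) = d - m"
          using T NL[of 0] cL[OF V(3)] by (subst card_Diff_subset) auto
        then show ?thesis using True Sr d2m by simp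
      next
        case False
        then show ?thesis using cN[of i] T(2) that by (simp add: S_def)
      qed
      have r0: "S i \<inter> S r = {}" if "i < r" for i
        using SL[OF that] S0 Sr Ldisj'[of i 0] that V(3) by (cases "i = 0") auto
      show "S i \<inter> S j = {}" if ij: "i < Suc r" "j < Suc r" "i \<noteq> j" for i j
      proof -
        consider "i < r" "j < r" | "i < r" "j = r" | "i = r" "j < r" using ij by linarith
        then show ?thesis
          by cases (use SL[of i] SL[of j] Ldisj'[of i j] r0 ij in \<open>auto simp: Int_commute\<close>)
      qed
    qed (rule that)
    have fL: "f i \<in> L i" if "i < r" for i using f(1)[of i] SL[OF that] that by auto
    have fr: "red w (f i)" if "i < r" for i
      using f(1)[of i] T(1) that by (auto simp: S_def N_def split: if_splits)
    show False
    proof (rule no_clique[of "f(r := w)"])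
      show "(f(r := w)) i \<in> V" if "i < Suc r" for i
        using w(1) WV fL[of i] LV[of i] that by (cases "i = r") auto
      show "red ((f(r := w)) i) ((f(r := w)) j)" if ij: "i < Suc r" "j < Suc r" "i \<noteq> j" for i j
      proof -
        consider "i < r" "j < r" | "i < r" "j = r" | "i = r" "j < r" using ij by linarith
        then show ?thesis
        proof cases
          case 1
          have "\<not> blue (f i) (f j)"
            by (rule no_blue[OF 1 ij(3) fL]) (use 1 fL LQ in blast)+
          then show ?thesis using f(2)[OF ij] 1 by simp
        next
          case 2
          then show ?thesis using fr[of i] red_commute by simp
        next
          case 3
          then show ?thesis using fr[of j] by simp
        qed
      qed
    qed
  qed
  \<comment> \<open>Otherwise each path has at most \<open>n + k\<close> vertices together with its
    \<open>E i\<close> and \<open>X i\<close>. These sets cover \<open>V\<close>, contrary to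
    \<open>r * k < t\<close>.\<close>
  have "\<exists>i<r. n < length (Q i) + card (X i)"
  proof (rule ccontr)
    assume "\<not> ?thesis"
    then have le: "length (Q i) + card (X i) \<le> n" if "i < r" for i using that by (meson not_less)
    have finEX: "finite (E i)" "finite (X i)" for i using finW by (auto simp: E_def X_def)
    have "V = (\<Union>i<r. set (Q i) \<union> (E i \<union> X i))"
      using cover QW by (auto simp: E_def X_def)
    then have "card V = card (\<Union>i<r. set (Q i) \<union> (E i \<union> X i))" by (rule arg_cong)
    also have "\<dots> \<le> (\<Sum>i<r. card (set (Q i) \<union> (E i \<union> X i)))"
      by (rule card_UN_le) simp
    also have "\<dots> \<le> (\<Sum>i<r. n + k)"
    proof (rule sum_mono)
      fix i assume "i \<in> {..<r}"
      then have i: "i < r" by simp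
      have "card (set (Q i) \<union> (E i \<union> X i)) \<le> card (set (Q i)) + (card (E i) + card (X i))"
        by (meson add_left_mono card_Un_le order_trans)
      then show "card (set (Q i) \<union> (E i \<union> X i)) \<le> n + k"
        using cE[OF i] le[OF i] card_length[of "Q i"] by linarith
    qed
    finally show False using V by (simp add: algebra_simps)
  qed
  then obtain i where i: "i < r" and big: "n < length (Q i) + card (X i)" by blast
  have XW: "X i \<subseteq> W" by (auto simp: X_def)
  \<comment> \<open>Absorption is done at once by taking a longest path \<open>R\<close> that
    contains \<open>Q i\<close> and otherwise uses only \<open>X i\<close>. Since \<open>Q i\<close>
    and \<open>X i\<close> together have more than \<open>n\<close> vertices, some \<open>y\<close>
    in \<open>X i\<close> is left out.\<close>
  define ok where "ok R \<longleftrightarrow> distinct R \<and> successively blue R \<and> set (Q i) \<subseteq> set R \<and>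
    set R \<subseteq> set (Q i) \<union> X i" for R
  have okn: "length R \<le> n" if "ok R" for R
  proof (rule short)
    have "set R \<subseteq> set (Q i) \<union> X i" using that by (simp add: ok_def)
    then show "set R \<subseteq> V" using QV[OF i] XW WV by blast
  qed (use that in \<open>simp_all add: ok_def\<close>)
  have "ok (Q i)" using Q(1,2) i by (simp add: ok_def)
  moreover have "\<forall>R. ok R \<longrightarrow> length R < Suc n" using okn by (simp add: less_Suc_eq_le)
  ultimately obtain R where R: "ok R" and max: "\<And>R'. ok R' \<Longrightarrow> length R' \<le> length R"
    using ex_has_greatest_nat[of ok "Q i" length "Suc n"] by blast
  have dR: "distinct R" and sR: "successively blue R" and QR: "set (Q i) \<subseteq> set R"
    and RQ: "set R \<subseteq> set (Q i) \<union> X i"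
    using R by (auto simp: ok_def)
  have "card (set (Q i) \<union> X i) = length (Q i) + card (X i)"
    using Q(1)[OF i] Q(4)[OF i] XW finW
    by (subst card_Un_disjoint) (auto simp: distinct_card dest: finite_subset)
  then have "set R \<noteq> set (Q i) \<union> X i"
    using okn[OF R] big dR by (auto simp: distinct_card dest!: arg_cong[of _ _ card])
  then obtain y where y: "y \<in> X i" "y \<notin> set R" using RQ QR by blast
  \<comment> \<open>A blue edge between the successors on \<open>R\<close> of two blue neighbours of \<open>y\<close> would let \<open>R\<close> absorb
    \<open>y\<close>, so these successors span no blue edge.\<close>
  define I where "I = {a. Suc a < length R \<and> blue y (R ! a)}"
  have finI: "finite I" by (rule finite_subset[of _ "{..<length R}"]) (auto simp: I_def)
  \<comment> \<open>The last position of \<open>R\<close> has no successor and is added back here;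
    it accounts for the summand 1 in the bound on \<open>D\<close>.\<close>
  have "{q \<in> L i. blue y q} \<subseteq> (!) R ` insert (length R - 1) I"
  proof
    fix q assume q: "q \<in> {q \<in> L i. blue y q}"
    then have "q \<in> set R" using LQ QR by blast
    then obtain a where a: "a < length R" "R ! a = q" by (auto simp: in_set_conv_nth)
    then have "a \<in> insert (length R - 1) I" using q by (auto simp: I_def)
    then show "q \<in> (!) R ` insert (length R - 1) I" using a by blast
  qed
  then have "card {q \<in> L i. blue y q} \<le> card ((!) R ` insert (length R - 1) I)"
    by (rule card_mono[rotated]) (simp add: finI)
  also have "\<dots> \<le> card (insert (length R - 1) I)" by (rule card_image_le) (simp add: finI)
  also have "\<dots> \<le> Suc (card I)" by (rule card_insert_le_m1) simp_all
  finally have cI: "D \<le> Suc (card I) + m" using y(1) by (auto simp: X_def)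
  define T where "T = (\<lambda>a. R ! Suc a) ` I"
  have "inj_on (\<lambda>a. R ! Suc a) I" using dR by (auto simp: inj_on_def I_def nth_eq_iff_index_eq)
  then have cT: "card T = card I" by (simp add: T_def card_image)
  have finT: "finite T" using finI by (simp add: T_def)
  \<comment> \<open>Removing \<open>W\<close> leaves only successors on \<open>Q i\<close> itself,
    where \<open>no_blue\<close> excludes blue edges to the other \<open>L j\<close>.\<close>
  have "card T - card W \<le> card (T - W)" by (rule diff_card_le_card_Diff[OF finW])
  then have cTW: "2 * m \<le> card (T - W)" using cT cI cW D rm_eq by linarith
  have "T \<subseteq> set R" by (auto simp: T_def I_def)
  then have TQ: "T - W \<subseteq> set (Q i)" using RQ XW by blast
  have no_ins: False if a: "a \<in> I" "b \<in> I" "a < b" "blue (R ! Suc a) (R ! Suc b)" for a b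
  proof -
    have "Suc b < length R" "blue (R ! a) y" "blue y (R ! b)"
      using a by (auto simp: I_def blue_commute)
    then obtain R' where R': "successively blue R'" "mset R' = add_mset y (mset R)"
      using successively_insert_vertex[OF sym_blue sR a(3)] a(4) by metis
    have m': "mset R' = mset (y # R)" using R'(2) by simp
    have "set R' = insert y (set R)" "length R' = Suc (length R)"
      using mset_eq_setD[OF m'] mset_eq_length[OF m'] by simp_all
    moreover have "distinct R'" using mset_eq_imp_distinct_iff[OF m'] dR y(2) by simp
    ultimately have "ok R'" "length R < length R'"
      using R'(1) QR RQ y(1) by (auto simp: ok_def)
    then show False using max by (meson not_less)
  qed
  have T_red: "\<not> blue u v" if uv: "u \<in> T" "v \<in> T" "u \<noteq> v" for u v
  proof
    assume bl: "blue u v"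
    obtain a b where ab: "a \<in> I" "b \<in> I" "u = R ! Suc a" "v = R ! Suc b"
      using uv by (auto simp: T_def)
    then have "a \<noteq> b" using uv(3) by auto
    then show False
      using no_ins[of a b] no_ins[of b a] ab bl blue_commute[of u v] by (meson linorder_neqE_nat)
  qed
  obtain T1 where T1: "T1 \<subseteq> T - W" "card T1 = m"
    using obtain_subset_with_card_n[of m "T - W"] cTW by auto
  \<comment> \<open>The successors are shared between the index \<open>i\<close> and the extra index
    \<open>r\<close>; the other indices use the path beginnings.\<close>
  define S where "S j = (if j = r then T - W - T1 else if j = i then T1 else L j)" for j
  have Si: "S i = T1" and Sr: "S r = T - W - T1" using i by (auto simp: S_def)
  have SL: "S j = L j" if "j < r" "j \<noteq> i" for j using that by (simp add: S_def)
  have "card (T - W - T1) = card (T - W) - m"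
    using T1 finT by (subst card_Diff_subset) (auto dest: finite_subset)
  then have cSr: "m \<le> card (S r)" using cTW Sr by simp
  have sep: "S a \<inter> S b = {} \<and> (\<forall>u\<in>S a. \<forall>v\<in>S b. \<not> blue u v)" if ab: "a < b" "b < Suc r" for a b
  proof -
    have LT: "L j \<inter> (T - W) = {} \<and> (\<forall>u\<in>L j. \<forall>v\<in>T - W. \<not> blue u v)" if j: "j < r" "j \<noteq> i" for j
      using Ldisj[OF j(1) i j(2)] TQ no_blue[OF j(1) i j(2)] by blast
    have TL: "(T - W) \<inter> L j = {} \<and> (\<forall>u\<in>T - W. \<forall>v\<in>L j. \<not> blue u v)" if j: "j < r" "j \<noteq> i" for j
      using LT[OF j] blue_commute by blast
    have TT: "T1 \<inter> (T - W - T1) = {} \<and> (\<forall>u\<in>T1. \<forall>v\<in>T - W - T1. \<not> blue u v)"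
      using T_red T1(1) by blast
    have ar: "a < r" using ab by simp
    consider "b = r" "a = i" | "b = r" "a \<noteq> i" | "b < r" "a = i" | "b < r" "b = i"
      | "b < r" "a \<noteq> i" "b \<noteq> i" using ab by linarith
    then show ?thesis
    proof cases
      case 1
      then show ?thesis using TT Si Sr by simp
    next
      case 2
      have "S r \<subseteq> T - W" using Sr by auto
      then show ?thesis using LT[OF ar 2(2)] SL[OF ar 2(2)] 2(1) by blast
    next
      case 3
      then have "b \<noteq> i" using ab by simp
      then show ?thesis using TL[OF 3(1)] SL[OF 3(1)] Si T1(1) 3(2) by blast
    next
      case 4
      then have "a \<noteq> i" using ab by simp
      then show ?thesis using LT[OF ar] SL[OF ar] Si T1(1) 4(2) by blast
    next
      case 5
      have "a \<noteq> b" using ab by simp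
      then show ?thesis
        using SL[OF ar 5(2)] SL[OF 5(1,3)] Ldisj[OF ar 5(1)] LQ[of b] no_blue[OF ar 5(1)] by blast
    qed
  qed
  show False
  proof (rule blue_between[OF TC])
    have TV: "T - W \<subseteq> V" using TQ QV[OF i] by blast
    show "S j \<subseteq> V" if j: "j < Suc r" for j
    proof -
      consider "j = r" | "j = i" | "j < r" "j \<noteq> i" using j by linarith
      then show ?thesis
        by cases (use TV T1(1) Si Sr SL[of j] LV[of j] in auto)
    qed
    show "m \<le> card (S j)" if j: "j < Suc r" for j
    proof -
      consider "j = r" | "j = i" | "j < r" "j \<noteq> i" using j by linarith
      then show ?thesis
        by cases (use cSr T1(2) Si SL[of j] cL[of j] d2m in auto)
    qed
    show "S a \<inter> S b = {}" if "a < Suc r" "b < Suc r" "a \<noteq> b" for a b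
      using sep[of a b] sep[of b a] that by (cases "a < b") auto
    show "\<not> blue u v" if "a < Suc r" "b < Suc r" "a \<noteq> b" "u \<in> S a" "v \<in> S b" for a b u v
      using sep[of a b] sep[of b a] that blue_commute[of u v] by (cases "a < b") auto
  qed
qed

end

section \<open>Random subsets\<close>

abbreviation random_subset :: "'a set \<Rightarrow> real \<Rightarrow> ('a \<Rightarrow> bool) pmf" where
  "random_subset A p \<equiv> Pi_pmf A False (\<lambda>_. bernoulli_pmf p)"

lemma prob_random_subset_insert:
  assumes "finite A" "e \<notin> A" "0 \<le> p" "p \<le> 1"
  shows "measure_pmf.prob (random_subset (insert e A) p) S =
    p * measure_pmf.prob (random_subset A p) {b. b(e := True) \<in> S} +
    (1 - p) * measure_pmf.prob (random_subset A p) {b. b(e := False) \<in> S}"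
proof -
  have "emeasure (random_subset (insert e A) p) S =
    emeasure (bind_pmf (bernoulli_pmf p) (\<lambda>y. map_pmf (\<lambda>b. b(e := y)) (random_subset A p))) S"
    using assms by (subst Pi_pmf_insert') (simp_all add: map_pmf_def)
  also have "\<dots> = emeasure (random_subset A p) {b. b(e := True) \<in> S} * ennreal p +
     emeasure (random_subset A p) {b. b(e := False) \<in> S} * ennreal (1 - p)"
    using assms by (simp add: vimage_def)
  finally have "ennreal (measure_pmf.prob (random_subset (insert e A) p) S) =
    ennreal (p * measure_pmf.prob (random_subset A p) {b. b(e := True) \<in> S} +
    (1 - p) * measure_pmf.prob (random_subset A p) {b. b(e := False) \<in> S})"
    using assms
    by (simp add: measure_pmf.emeasure_eq_measure ennreal_mult' ennreal_plus mult.commute)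
  then show ?thesis using assms by (subst (asm) ennreal_inj) auto
qed

lemma prob_present_one:
  assumes "finite A" "e \<in> A" "0 \<le> p" "p \<le> 1"
  shows "measure_pmf.prob (random_subset A p) {b. b e \<and> X b} =
    p * measure_pmf.prob (random_subset A p) {b. X (b(e := True))}"
proof -
  have A: "A = insert e (A - {e})" using assms by auto
  have "measure_pmf.prob (random_subset A p) {b. b e \<and> X b} =
    p * measure_pmf.prob (random_subset (A - {e}) p) {b. X (b(e := True))}"
    using assms by (subst A, subst prob_random_subset_insert) simp_all
  moreover have "measure_pmf.prob (random_subset A p) {b. X (b(e := True))} =
    measure_pmf.prob (random_subset (A - {e}) p) {b. X (b(e := True))}"
    using assms by (subst A, subst prob_random_subset_insert) (simp_all add: algebra_simps)
  ultimately show ?thesis by simp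
qed

text \<open>Coordinates are independent, so conditioning on \<open>F\<close> being present merely
  switches the coordinates in \<open>F\<close> on. Keeping \<open>X\<close> arbitrary lets the
  induction treat one coordinate at a time.\<close>

lemma prob_present:
  assumes "finite A" "F \<subseteq> A" "0 \<le> p" "p \<le> 1"
  shows "measure_pmf.prob (random_subset A p) {b. (\<forall>e\<in>F. b e) \<and> X b} =
    p ^ card F * measure_pmf.prob (random_subset A p) {b. X (\<lambda>e. b e \<or> e \<in> F)}"
proof -
  have "finite F" using assms by (auto intro: finite_subset)
  then show ?thesis using assms(2)
  proof (induction F arbitrary: X rule: finite_induct)
    case empty
    show ?case by simp
  next
    case (insert e F)
    have "measure_pmf.prob (random_subset A p) {b. (\<forall>x\<in>insert e F. b x) \<and> X b} =
      measure_pmf.prob (random_subset A p) {b. (\<forall>x\<in>F. b x) \<and> (b e \<and> X b)}"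
      by (rule arg_cong[where f = "measure_pmf.prob _"]) auto
    also have "\<dots> = p ^ card F * measure_pmf.prob (random_subset A p)
        {b. b e \<and> X (\<lambda>x. b x \<or> x \<in> F)}"
      using insert by (subst insert.IH) auto
    also have "\<dots> = p ^ card F * (p * measure_pmf.prob (random_subset A p)
        {b. X (\<lambda>x. (b(e := True)) x \<or> x \<in> F)})"
      using assms insert.prems by (subst prob_present_one) simp_all
    also have "{b. X (\<lambda>x. (b(e := True)) x \<or> x \<in> F)} = {b. X (\<lambda>x. b x \<or> x \<in> insert e F)}"
    proof -
      have "(\<lambda>x. (b(e := True)) x \<or> x \<in> F) = (\<lambda>x. b x \<or> x \<in> insert e F)" for b
        by auto
      then show ?thesis by simp
    qed
    finally show ?case using insert by simp
  qed
qed

text \<open>Conditioning on the presence of \<open>E i\<close> is the map \<open>b \<mapsto> b \<or> E i\<close>, which leaves the sets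
  disjoint from \<open>E i\<close> unaffected and can only decrease the chance of a decreasing event.  The
  union bound over the remaining sets therefore loses at most the factor \<open>1/2\<close>.\<close>

lemma prob_avoid_all:
  assumes "finite A" "finite I" "0 \<le> p" "p \<le> 1"
    and sub: "\<And>i. i \<in> I \<Longrightarrow> E i \<subseteq> A"
    and dep: "\<And>i. i \<in> I \<Longrightarrow>
      (\<Sum>j\<in>{j \<in> I. j \<noteq> i \<and> E i \<inter> E j \<noteq> {}}. p ^ card (E j - E i)) \<le> 1 / 2"
  shows "measure_pmf.prob (random_subset A p) {b. \<forall>i\<in>I. \<not> (\<forall>e\<in>E i. b e)}
    \<le> exp (- (\<Sum>i\<in>I. p ^ card (E i)) / 2)"
proof -
  define pr where "pr X = measure_pmf.prob (random_subset A p) {b. X b}" for X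
  define av where "av J b \<longleftrightarrow> (\<forall>i\<in>J. \<not> (\<forall>e\<in>E i. b e))" for J and b :: "'a \<Rightarrow> bool"
  have mono: "pr X \<le> pr Y" if "\<And>b. X b \<Longrightarrow> Y b" for X Y
    unfolding pr_def by (rule measure_pmf.finite_measure_mono) (use that in auto)
  have pr0: "0 \<le> pr X" for X by (simp add: pr_def)
  have fE: "finite (E i)" if "i \<in> I" for i using sub[OF that] assms(1) by (rule finite_subset)
  have "pr (av J) \<le> exp (- (\<Sum>i\<in>J. p ^ card (E i)) / 2)" if "J \<subseteq> I" for J
  proof -
    have "finite J" using that assms(2) by (rule finite_subset)
    then show ?thesis using that
    proof (induction J rule: finite_induct)
      case empty
      show ?case by (simp add: pr_def)
    next
      case (insert i J)
      then have iI: "i \<in> I" and JI: "J \<subseteq> I" by auto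
      \<comment> \<open>\<open>D\<close> collects the earlier events that interact with event
        \<open>i\<close>; avoiding the rest \<open>N\<close> is independent of the presence of
        \<open>E i\<close>.\<close>
      define D where "D = {j \<in> J. E i \<inter> E j \<noteq> {}}"
      define N where "N = J - D"
      have finJ: "finite J" using insert by simp
      have DI: "D \<subseteq> I" using JI by (auto simp: D_def)
      have present: "pr (\<lambda>b. (\<forall>e\<in>F. b e) \<and> X b) = p ^ card F * pr (\<lambda>b. X (\<lambda>e. b e \<or> e \<in> F))"
        if "F \<subseteq> A" for F X
        unfolding pr_def using assms that by (intro prob_present) auto
      have "pr (\<lambda>b. (\<forall>e\<in>E i. b e) \<and> av N b) = p ^ card (E i) * pr (\<lambda>b. av N (\<lambda>e. b e \<or> e \<in> E i))"
        by (rule present) (rule sub[OF iI])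
      also have "(\<lambda>b. av N (\<lambda>e. b e \<or> e \<in> E i)) = av N"
        unfolding av_def N_def D_def by (intro ext ball_cong refl) blast
      finally have indep: "pr (\<lambda>b. (\<forall>e\<in>E i. b e) \<and> av N b) = p ^ card (E i) * pr (av N)" .
      have corr: "pr (\<lambda>b. (\<forall>e\<in>E i. b e) \<and> (\<forall>e\<in>E j. b e) \<and> av N b)
          \<le> p ^ card (E i) * p ^ card (E j - E i) * pr (av N)" if j: "j \<in> D" for j
      proof -
        have jI: "j \<in> I" using j DI by auto
        have "pr (\<lambda>b. (\<forall>e\<in>E i. b e) \<and> (\<forall>e\<in>E j. b e) \<and> av N b)
          = pr (\<lambda>b. (\<forall>e\<in>E i \<union> E j. b e) \<and> av N b)"
          by (rule arg_cong[where f = pr]) auto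
        also have "\<dots> = p ^ card (E i \<union> E j) * pr (\<lambda>b. av N (\<lambda>e. b e \<or> e \<in> E i \<union> E j))"
          by (rule present) (use sub iI jI in auto)
        also have "card (E i \<union> E j) = card (E i) + card (E j - E i)"
          using fE[OF iI] fE[OF jI] by (subst card_Un_disjoint[symmetric]) auto
        also have "pr (\<lambda>b. av N (\<lambda>e. b e \<or> e \<in> E i \<union> E j)) \<le> pr (av N)"
          by (rule mono) (auto simp: av_def)
        finally show ?thesis using assms(3) by (simp add: power_add mult_left_mono)
      qed
      have "pr (\<lambda>b. (\<forall>e\<in>E i. b e) \<and> av N b) \<le> pr (\<lambda>b. (\<forall>e\<in>E i. b e) \<and> av J b) +
        (\<Sum>j\<in>D. pr (\<lambda>b. (\<forall>e\<in>E i. b e) \<and> (\<forall>e\<in>E j. b e) \<and> av N b))"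
      proof -
        have "pr (\<lambda>b. (\<forall>e\<in>E i. b e) \<and> av N b) \<le> measure_pmf.prob (random_subset A p)
          ({b. (\<forall>e\<in>E i. b e) \<and> av J b} \<union> (\<Union>j\<in>D. {b. (\<forall>e\<in>E i. b e) \<and> (\<forall>e\<in>E j. b e) \<and> av N b}))"
          unfolding pr_def
        proof (rule measure_pmf.finite_measure_mono)
          have "av N b \<Longrightarrow> \<not> av J b \<Longrightarrow> \<exists>j\<in>D. \<forall>e\<in>E j. b e" for b
            unfolding av_def N_def by blast
          then show "{b. (\<forall>e\<in>E i. b e) \<and> av N b} \<subseteq> {b. (\<forall>e\<in>E i. b e) \<and> av J b} \<union>
              (\<Union>j\<in>D. {b. (\<forall>e\<in>E i. b e) \<and> (\<forall>e\<in>E j. b e) \<and> av N b})"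
            by blast
        qed simp
        also have "\<dots> \<le> pr (\<lambda>b. (\<forall>e\<in>E i. b e) \<and> av J b) + measure_pmf.prob (random_subset A p)
          (\<Union>j\<in>D. {b. (\<forall>e\<in>E i. b e) \<and> (\<forall>e\<in>E j. b e) \<and> av N b})"
          unfolding pr_def by (rule measure_Un_le) auto
        also have "measure_pmf.prob (random_subset A p)
          (\<Union>j\<in>D. {b. (\<forall>e\<in>E i. b e) \<and> (\<forall>e\<in>E j. b e) \<and> av N b})
          \<le> (\<Sum>j\<in>D. pr (\<lambda>b. (\<forall>e\<in>E i. b e) \<and> (\<forall>e\<in>E j. b e) \<and> av N b))"
          unfolding pr_def using finJ
          by (intro measure_pmf.finite_measure_subadditive_finite) (auto simp: D_def)
        finally show ?thesis by simp
      qed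
      also have "(\<Sum>j\<in>D. pr (\<lambda>b. (\<forall>e\<in>E i. b e) \<and> (\<forall>e\<in>E j. b e) \<and> av N b))
        \<le> (\<Sum>j\<in>D. p ^ card (E i) * p ^ card (E j - E i) * pr (av N))"
        by (rule sum_mono) (rule corr)
      also have "\<dots> = p ^ card (E i) * pr (av N) * (\<Sum>j\<in>D. p ^ card (E j - E i))"
        by (simp add: sum_distrib_left mult_ac)
      also have "(\<Sum>j\<in>D. p ^ card (E j - E i)) \<le>
          (\<Sum>j\<in>{j \<in> I. j \<noteq> i \<and> E i \<inter> E j \<noteq> {}}. p ^ card (E j - E i))"
        using insert.hyps JI assms(2,3) by (intro sum_mono2) (auto simp: D_def)
      also have "\<dots> \<le> 1 / 2" by (rule dep[OF iI])
      finally have "p ^ card (E i) * pr (av N) \<le>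
          pr (\<lambda>b. (\<forall>e\<in>E i. b e) \<and> av J b) + p ^ card (E i) * pr (av N) * (1 / 2)"
        unfolding indep using pr0 assms(3) by (simp add: mult_left_mono)
      moreover have "p ^ card (E i) * pr (av J) \<le> p ^ card (E i) * pr (av N)"
        using assms(3) by (intro mult_left_mono mono) (auto simp: av_def N_def)
      \<comment> \<open>Avoiding \<open>J\<close> implies avoiding \<open>N\<close>, so
        \<open>pr (av N)\<close> may be replaced by the smaller \<open>pr (av J)\<close>. Adding
        event \<open>i\<close> thus multiplies the avoidance probability by at most
        \<open>1 - p ^ card (E i) / 2\<close>.\<close>
      ultimately have half: "p ^ card (E i) * pr (av J) / 2 \<le> pr (\<lambda>b. (\<forall>e\<in>E i. b e) \<and> av J b)"
        by simp
      have "pr (av J) = pr (av (insert i J)) + pr (\<lambda>b. (\<forall>e\<in>E i. b e) \<and> av J b)"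
        unfolding pr_def
        by (subst measure_pmf.finite_measure_Union[symmetric])
           (auto simp: av_def intro!: arg_cong[where f = "measure_pmf.prob _"])
      then have "pr (av (insert i J)) \<le> pr (av J) * (1 - p ^ card (E i) / 2)"
        using half by (simp add: algebra_simps)
      also have "\<dots> \<le> pr (av J) * exp (- (p ^ card (E i) / 2))"
        using exp_ge_add_one_self[of "- (p ^ card (E i) / 2)"] pr0 by (intro mult_left_mono) auto
      also have "\<dots> \<le> exp (- (\<Sum>i\<in>J. p ^ card (E i)) / 2) * exp (- (p ^ card (E i) / 2))"
        using insert.IH[OF JI] by (intro mult_right_mono) auto
      also have "\<dots> = exp (- (\<Sum>i\<in>insert i J. p ^ card (E i)) / 2)"
        using insert.hyps by (simp add: exp_add[symmetric] add_divide_distrib diff_divide_distrib)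
      finally show ?case .
    qed
  qed
  then show ?thesis by (simp add: pr_def av_def)
qed

text \<open>An exponential Markov bound with parameter 1: \<open>exp\<close> of \<open>a\<close>
  minus the count dominates the indicator, its expectation factorises over the coordinates, and
  \<open>exp (- 1) \<le> 1 / 2\<close> bounds each factor by \<open>exp (- (p / 2))\<close>.\<close>

lemma prob_few_present:
  assumes "finite A" "F \<subseteq> A" "0 \<le> p" "p \<le> 1"
  shows "measure_pmf.prob (random_subset A p) {b. real (card {e \<in> F. b e}) \<le> a}
    \<le> exp (a - p * card F / 2)"
proof -
  let ?M = "random_subset A p"
  define g :: "'a \<Rightarrow> bool \<Rightarrow> real" where "g x v = (if x \<in> F \<and> v then exp (- 1) else 1)" for x v
  have fin: "finite (set_pmf ?M)"
    using assms(1) by (simp add: set_Pi_pmf finite_PiE_dflt)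
  have finF: "finite F" using assms by (auto intro: finite_subset)
  have g: "(\<Prod>x\<in>A. g x (b x)) = exp (- real (card {e \<in> F. b e}))" for b
  proof -
    have "(\<Prod>x\<in>A. g x (b x)) = (\<Prod>x\<in>{e \<in> F. b e}. exp (- 1))"
      using assms(1,2) by (intro prod.mono_neutral_cong_right) (auto simp: g_def)
    then show ?thesis by (simp add: exp_of_nat_mult[symmetric])
  qed
  have "measure_pmf.prob ?M {b. real (card {e \<in> F. b e}) \<le> a} =
    measure_pmf.expectation ?M (indicator {b. real (card {e \<in> F. b e}) \<le> a})"
    by simp
  also have "\<dots> \<le> measure_pmf.expectation ?M (\<lambda>b. exp a * (\<Prod>x\<in>A. g x (b x)))"
    using fin by (intro integral_mono integrable_measure_pmf_finite)
      (auto simp: indicator_def g exp_add[symmetric])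
  also have "\<dots> = exp a * (\<Prod>x\<in>A. measure_pmf.expectation (bernoulli_pmf p) (g x))"
    using assms(1)
    by (subst expectation_prod_Pi_pmf[symmetric]) (auto simp: integrable_measure_pmf_finite g_def)
  also have "(\<Prod>x\<in>A. measure_pmf.expectation (bernoulli_pmf p) (g x)) = (\<Prod>x\<in>F. exp (- 1) * p + (1 - p))"
    using assms by (intro prod.mono_neutral_cong_right) (auto simp: g_def)
  also have "\<dots> = (exp (- 1) * p + (1 - p)) ^ card F" by simp
  also have "\<dots> \<le> exp (- (p / 2)) ^ card F"
  proof (rule power_mono)
    have "exp (- 1 :: real) \<le> 1 / 2"
      using exp_ge_add_one_self[of 1] by (simp add: exp_minus field_simps)
    then have "exp (- 1) * p \<le> 1 / 2 * p" using assms(3) by (intro mult_right_mono)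
    then show "exp (- 1) * p + (1 - p) \<le> exp (- (p / 2))"
      using exp_ge_add_one_self[of "- (p / 2)"] by simp
    show "0 \<le> exp (- 1) * p + (1 - p)" using assms by simp
  qed
  also have "\<dots> = exp (- (p * card F / 2))" by (simp add: exp_of_nat_mult[symmetric] mult_ac)
  finally show ?thesis by (simp add: exp_add[symmetric])
qed

section \<open>Transversal cliques and degrees in the random graph\<close>

definition adj_in :: "('a set \<Rightarrow> bool) \<Rightarrow> 'a \<Rightarrow> 'a \<Rightarrow> bool" where
  "adj_in b u v \<longleftrightarrow> u \<noteq> v \<and> b {u, v}"

lemma finite_all_pairs: "finite V \<Longrightarrow> finite (all_pairs V)"
  by (auto simp: all_pairs_def)

lemma card_all_pairs: "finite V \<Longrightarrow> card (all_pairs V) = card V choose 2"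
  unfolding all_pairs_def by (rule n_subsets)

lemma all_pairs_Int: "all_pairs X \<inter> all_pairs Y = all_pairs (X \<inter> Y)"
  by (auto simp: all_pairs_def)

lemma all_pairs_mono: "X \<subseteq> Y \<Longrightarrow> all_pairs X \<subseteq> all_pairs Y"
  by (auto simp: all_pairs_def)

lemma doubleton_in_all_pairs: "u \<in> V \<Longrightarrow> v \<in> V \<Longrightarrow> u \<noteq> v \<Longrightarrow> {u, v} \<in> all_pairs V"
  by (auto simp: all_pairs_def)

context
  fixes k :: nat and S :: "nat \<Rightarrow> 'a set"
  assumes disj: "disjoint_family_on S {..<k}"
begin

lemma transversal_inj:
  assumes "f \<in> PiE {..<k} S"
  shows "inj_on f {..<k}"
proof (rule inj_onI, rule ccontr)
  fix i j assume ij: "i \<in> {..<k}" "j \<in> {..<k}" "f i = f j" "i \<noteq> j"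
  have "f i \<in> S i" "f j \<in> S j" using PiE_mem[OF assms] ij(1,2) by blast+
  moreover have "S i \<inter> S j = {}" using disjoint_family_onD[OF disj ij(1,2,4)] .
  ultimately show False using ij(3) by auto
qed

text \<open>Since the sets \<open>S i\<close> are disjoint, a common vertex sits at the same index
  in both transversals.\<close>

lemma transversal_Int:
  assumes "f \<in> PiE {..<k} S" "g \<in> PiE {..<k} S"
  shows "f ` {..<k} \<inter> g ` {..<k} = f ` {i \<in> {..<k}. f i = g i}"
proof -
  have "i = j" if "i < k" "j < k" "f i = g j" for i j
    using disj assms that unfolding disjoint_family_on_def
    by (metis PiE_mem disjoint_iff lessThan_iff)
  then show ?thesis by (fastforce simp: image_iff)
qed

lemma transversal_pairs_card:
  assumes "f \<in> PiE {..<k} S" "g \<in> PiE {..<k} S"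
  shows "card (all_pairs (f ` {..<k})) = k choose 2"
    and "card (all_pairs (f ` {..<k}) \<inter> all_pairs (g ` {..<k})) =
      card {i \<in> {..<k}. f i = g i} choose 2"
    and "card (all_pairs (g ` {..<k}) - all_pairs (f ` {..<k})) =
      (k choose 2) - (card {i \<in> {..<k}. f i = g i} choose 2)"
proof -
  have inj: "inj_on f {..<k}" "inj_on g {..<k}"
    by (rule transversal_inj[OF assms(1)], rule transversal_inj[OF assms(2)])
  show "card (all_pairs (f ` {..<k})) = k choose 2"
    using inj by (simp add: card_all_pairs card_image)
  have card_g: "card (all_pairs (g ` {..<k})) = k choose 2"
    using inj by (simp add: card_all_pairs card_image)
  show meet: "card (all_pairs (f ` {..<k}) \<inter> all_pairs (g ` {..<k})) =
      card {i \<in> {..<k}. f i = g i} choose 2"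
  proof -
    have "inj_on f {i \<in> {..<k}. f i = g i}" by (rule inj_on_subset[OF inj(1)]) auto
    then have "card (f ` {i \<in> {..<k}. f i = g i}) = card {i \<in> {..<k}. f i = g i}"
      by (rule card_image)
    then show ?thesis
      unfolding all_pairs_Int transversal_Int[OF assms] by (subst card_all_pairs) simp_all
  qed
  show "card (all_pairs (g ` {..<k}) - all_pairs (f ` {..<k})) =
      (k choose 2) - (card {i \<in> {..<k}. f i = g i} choose 2)"
    using card_g meet by (subst card_Diff_subset_Int) (auto simp: finite_all_pairs Int_commute)
qed

text \<open>The family \<open>F\<close> of candidate cliques is kept free: all transversals serve
  for small \<open>p\<close>, progressions for large \<open>p\<close>. Two candidates share an edge
  exactly when they agree in at least two positions, which turns \<open>dep\<close> into the
  hypothesis of \<open>prob_avoid_all\<close>.\<close>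

lemma prob_no_transversal_clique:
  fixes p :: real
  assumes "finite A" "0 \<le> p" "p \<le> 1"
    and V: "\<And>i. i < k \<Longrightarrow> S i \<subseteq> V" "all_pairs V \<subseteq> A"
    and F: "finite F" "F \<subseteq> PiE {..<k} S"
    and dep: "\<And>f. f \<in> F \<Longrightarrow>
      (\<Sum>g\<in>{g \<in> F. g \<noteq> f \<and> 2 \<le> card {i \<in> {..<k}. f i = g i}}.
        p ^ ((k choose 2) - (card {i \<in> {..<k}. f i = g i} choose 2))) \<le> 1 / 2"
  shows "measure_pmf.prob (random_subset A p) {b. \<not> transversal_clique k S (adj_in b)}
    \<le> exp (- (card F * p ^ (k choose 2)) / 2)"
proof -
  define E where "E f = all_pairs (f ` {..<k})" for f :: "nat \<Rightarrow> 'a"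
  have meet: "E f \<inter> E g \<noteq> {} \<longleftrightarrow> 2 \<le> card {i \<in> {..<k}. f i = g i}" if "f \<in> F" "g \<in> F" for f g
  proof -
    have "E f \<inter> E g \<noteq> {} \<longleftrightarrow> card (E f \<inter> E g) \<noteq> 0"
      by (simp add: E_def finite_all_pairs)
    also have "card (E f \<inter> E g) = card {i \<in> {..<k}. f i = g i} choose 2"
      unfolding E_def using that F(2) by (intro transversal_pairs_card) auto
    also have "\<dots> \<noteq> 0 \<longleftrightarrow> 2 \<le> card {i \<in> {..<k}. f i = g i}"
      by (simp add: binomial_eq_0_iff not_less)
    finally show ?thesis .
  qed
  have "measure_pmf.prob (random_subset A p) {b. \<not> transversal_clique k S (adj_in b)}
    \<le> measure_pmf.prob (random_subset A p) {b. \<forall>f\<in>F. \<not> (\<forall>e\<in>E f. b e)}"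
  proof (rule measure_pmf.finite_measure_mono)
    show "{b. \<not> transversal_clique k S (adj_in b)} \<subseteq> {b. \<forall>f\<in>F. \<not> (\<forall>e\<in>E f. b e)}"
    proof (intro subsetI CollectI ballI notI)
      fix b f assume b: "b \<in> {b. \<not> transversal_clique k S (adj_in b)}"
        and f: "f \<in> F" "\<forall>e\<in>E f. b e"
      have fS: "f \<in> PiE {..<k} S" using f F(2) by auto
      have "adj_in b (f i) (f j)" if "i < k" "j < k" "i \<noteq> j" for i j
      proof -
        have ne: "f i \<noteq> f j" using transversal_inj[OF fS] that by (auto simp: inj_on_def)
        then have "{f i, f j} \<in> E f"
          unfolding E_def using that by (intro doubleton_in_all_pairs) auto
        then show ?thesis using ne f(2) by (simp add: adj_in_def)
      qed
      moreover have "f i \<in> S i" if "i < k" for i using fS that by auto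
      ultimately show False using b unfolding transversal_clique_def by blast
    qed
  qed simp
  also have "\<dots> \<le> exp (- (\<Sum>f\<in>F. p ^ card (E f)) / 2)"
  proof (rule prob_avoid_all[OF assms(1) F(1) assms(2,3)])
    fix f assume f: "f \<in> F"
    then have "f ` {..<k} \<subseteq> V" using F(2) V(1) by blast
    then show "E f \<subseteq> A" unfolding E_def using V(2) all_pairs_mono by blast
    have "(\<Sum>g\<in>{g \<in> F. g \<noteq> f \<and> E f \<inter> E g \<noteq> {}}. p ^ card (E g - E f)) =
      (\<Sum>g\<in>{g \<in> F. g \<noteq> f \<and> 2 \<le> card {i \<in> {..<k}. f i = g i}}.
        p ^ ((k choose 2) - (card {i \<in> {..<k}. f i = g i} choose 2)))"
    proof (rule sum.cong)
      show "{g \<in> F. g \<noteq> f \<and> E f \<inter> E g \<noteq> {}} =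
          {g \<in> F. g \<noteq> f \<and> 2 \<le> card {i \<in> {..<k}. f i = g i}}"
        using meet[OF f] by blast
      fix g assume "g \<in> {g \<in> F. g \<noteq> f \<and> 2 \<le> card {i \<in> {..<k}. f i = g i}}"
      then have "g \<in> PiE {..<k} S" "f \<in> PiE {..<k} S" using f F(2) by auto
      then show "p ^ card (E g - E f) =
          p ^ ((k choose 2) - (card {i \<in> {..<k}. f i = g i} choose 2))"
        unfolding E_def by (simp add: transversal_pairs_card)
    qed
    also have "\<dots> \<le> 1 / 2" by (rule dep[OF f])
    finally show "(\<Sum>g\<in>{g \<in> F. g \<noteq> f \<and> E f \<inter> E g \<noteq> {}}. p ^ card (E g - E f)) \<le> 1 / 2" .
  qed
  also have "(\<Sum>f\<in>F. p ^ card (E f)) = card F * p ^ (k choose 2)"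
  proof -
    have "p ^ card (E f) = p ^ (k choose 2)" if "f \<in> F" for f
      using that F(2) transversal_pairs_card(1) unfolding E_def by (metis subsetD)
    then show ?thesis by simp
  qed
  finally show ?thesis by simp
qed

text \<open>Candidates sharing an edge with \<open>f\<close> are grouped by the index set
  \<open>I\<close> on which they agree with \<open>f\<close>. There are at most \<open>2 ^ k\<close>
  such sets and at most \<open>s ^ (k - card I)\<close> candidates for each, so \<open>small\<close>
  bounds the share of every group in the dependency sum.\<close>

lemma prob_no_transversal_clique_all:
  fixes p :: real
  assumes "finite A" "0 \<le> p" "p \<le> 1"
    and V: "\<And>i. i < k \<Longrightarrow> S i \<subseteq> V" "all_pairs V \<subseteq> A" "finite V"
    and S: "\<And>i. i < k \<Longrightarrow> card (S i) = s"
    and small: "\<And>j. 2 \<le> j \<Longrightarrow> j < k \<Longrightarrow>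
      2 ^ k * (real s ^ (k - j) * p ^ ((k choose 2) - (j choose 2))) \<le> 1 / 2"
  shows "measure_pmf.prob (random_subset A p) {b. \<not> transversal_clique k S (adj_in b)}
    \<le> exp (- (real s ^ k * p ^ (k choose 2)) / 2)"
proof -
  let ?F = "PiE {..<k} S"
  have finS: "finite (S i)" if "i < k" for i using V that by (meson finite_subset)
  then have finF: "finite ?F" by (intro finite_PiE) auto
  have "card ?F = s ^ k" using S by (simp add: card_PiE)
  moreover have "measure_pmf.prob (random_subset A p) {b. \<not> transversal_clique k S (adj_in b)}
    \<le> exp (- (card ?F * p ^ (k choose 2)) / 2)"
  proof (rule prob_no_transversal_clique[OF assms(1-5) finF order_refl])
    fix f assume f: "f \<in> ?F"
    define J where "J g = {i \<in> {..<k}. f i = g i}" for g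
    define P where "P = {I. I \<subseteq> {..<k} \<and> 2 \<le> card I \<and> card I < k}"
    define w where "w I = p ^ ((k choose 2) - (card I choose 2))" for I :: "nat set"
    let ?G = "{g \<in> ?F. g \<noteq> f \<and> 2 \<le> card (J g)}"
    have "P \<subseteq> Pow {..<k}" by (auto simp: P_def)
    then have finP: "finite P" and cP: "card P \<le> 2 ^ k"
      using card_mono[of "Pow {..<k}" P] by (auto simp: card_Pow intro: finite_subset)
    have JP: "J ` ?G \<subseteq> P"
    proof
      fix I assume "I \<in> J ` ?G"
      then obtain g where g: "g \<in> ?F" "g \<noteq> f" "2 \<le> card (J g)" "I = J g" by auto
      obtain i where i: "i < k" "f i \<noteq> g i" using f g(1,2) by (metis PiE_ext lessThan_iff)
      have "J g \<subset> {..<k}" using i by (auto simp: J_def)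
      then have "card (J g) < card {..<k}" by (intro psubset_card_mono) auto
      then show "I \<in> P" using g by (auto simp: P_def J_def)
    qed
    have "(\<Sum>g\<in>?G. w (J g)) = (\<Sum>I\<in>P. \<Sum>g\<in>{g \<in> ?G. J g = I}. w (J g))"
      using finF finP JP by (intro sum.group[symmetric]) auto
    also have "\<dots> \<le> (\<Sum>I\<in>P. 1 / (2 * 2 ^ k))"
    proof (rule sum_mono)
      fix I assume I: "I \<in> P"
      define T where "T i = (if i \<in> I then {f i} else S i)" for i
      have finI: "finite I" using I by (auto simp: P_def intro: finite_subset)
      have "{g \<in> ?G. J g = I} \<subseteq> PiE {..<k} T"
        by (auto simp: J_def T_def PiE_iff extensional_def)
      moreover have "finite (PiE {..<k} T)"
        using finS by (intro finite_PiE) (auto simp: T_def)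
      ultimately have "card {g \<in> ?G. J g = I} \<le> card (PiE {..<k} T)" by (simp add: card_mono)
      also have "\<dots> = (\<Prod>i<k. card (T i))" by (simp add: card_PiE)
      also have "\<dots> = (\<Prod>i\<in>{..<k} - I. s)"
        using S by (intro prod.mono_neutral_cong_right) (auto simp: T_def)
      also have "\<dots> = s ^ (k - card I)"
        using I finI by (simp add: P_def card_Diff_subset)
      finally have c: "card {g \<in> ?G. J g = I} \<le> s ^ (k - card I)" .
      have "(\<Sum>g\<in>{g \<in> ?G. J g = I}. w (J g)) = (\<Sum>g\<in>{g \<in> ?G. J g = I}. w I)"
        by (rule sum.cong) auto
      also have "\<dots> = card {g \<in> ?G. J g = I} * w I" by simp
      also have "\<dots> \<le> real (s ^ (k - card I)) * w I"
        using c assms(2) by (intro mult_right_mono) (auto simp: w_def simp del: of_nat_power)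
      also have "\<dots> \<le> 1 / (2 * 2 ^ k)"
        using small[of "card I"] I by (simp add: P_def w_def field_simps)
      finally show "(\<Sum>g\<in>{g \<in> ?G. J g = I}. w (J g)) \<le> 1 / (2 * 2 ^ k)" .
    qed
    also have "\<dots> = card P * (1 / (2 * 2 ^ k))" by simp
    also have "\<dots> \<le> 2 ^ k * (1 / (2 * 2 ^ k))"
    proof (rule mult_right_mono)
      show "real (card P) \<le> 2 ^ k" using of_nat_mono[OF cP, where 'a = real] by simp
    qed simp
    finally show "(\<Sum>g\<in>{g \<in> ?F. g \<noteq> f \<and> 2 \<le> card {i \<in> {..<k}. f i = g i}}.
        p ^ ((k choose 2) - (card {i \<in> {..<k}. f i = g i} choose 2))) \<le> 1 / 2"
      by (simp add: J_def w_def)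
  qed
  ultimately show ?thesis by simp
qed

text \<open>Transversals along arithmetic progressions share at most one vertex pairwise, so the
  corresponding cliques are edge disjoint and no density assumption is needed.\<close>

lemma prob_no_transversal_clique_progressions:
  fixes p :: real
  assumes "finite A" "0 \<le> p" "p \<le> 1"
    and V: "\<And>i. i < k \<Longrightarrow> S i \<subseteq> V" "all_pairs V \<subseteq> A" "finite V"
    and S: "\<And>i. i < k \<Longrightarrow> card (S i) = k * d" and k: "2 \<le> k"
  shows "measure_pmf.prob (random_subset A p) {b. \<not> transversal_clique k S (adj_in b)}
    \<le> exp (- (real d ^ 2 * p ^ (k choose 2)) / 2)"
proof -
  have finS: "finite (S i)" if "i < k" for i using V that by (meson finite_subset)
  then have "\<exists>h. bij_betw h {0..<k * d} (S i)" if "i < k" for i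
    using ex_bij_betw_nat_finite[OF finS[OF that]] S[OF that] by simp
  then obtain h where h: "\<And>i. i < k \<Longrightarrow> bij_betw (h i) {0..<k * d} (S i)" by metis
  \<comment> \<open>The pair \<open>(x, y)\<close> selects the element numbered
    \<open>x + i * y\<close> from \<open>S i\<close>. This number stays below
    \<open>d + (k - 1) * d\<close>, hence the size \<open>k * d\<close> of the sets.\<close>
  define g where "g = (\<lambda>(x, y). \<lambda>i\<in>{..<k}. h i (x + i * y))"
  let ?D = "{..<d} \<times> {..<d}"
  have bound: "x + i * y < k * d" if "x < d" "y < d" "i < k" for x y i
  proof -
    have "x + i * y < d + i * d" using that by (simp add: add_less_le_mono)
    also have "\<dots> = Suc i * d" by simp
    also have "\<dots> \<le> k * d" using that by (intro mult_right_mono) auto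
    finally show ?thesis .
  qed
  have agree: "z = z'" if z: "z \<in> ?D" "z' \<in> ?D" and ij: "i < k" "j < k" "i \<noteq> j"
    "g z i = g z' i" "g z j = g z' j" for z z' i j
  proof -
    obtain x y x' y' where xy: "z = (x, y)" "z' = (x', y')" by force
    have eq: "x + l * y = x' + l * y'" if "l < k" "g z l = g z' l" for l
    proof -
      have "h l (x + l * y) = h l (x' + l * y')" using that unfolding g_def xy by simp
      moreover have "inj_on (h l) {0..<k * d}" using h[OF that(1)] by (simp add: bij_betw_def)
      moreover have "x + l * y < k * d" "x' + l * y' < k * d"
        using bound that(1) z by (auto simp: xy)
      ultimately show ?thesis by (rule_tac inj_onD[of "h l" "{0..<k * d}"]) simp_all
    qed
    have "int x + int i * int y = int x' + int i * int y'"
      using arg_cong[OF eq[OF ij(1,4)], of int] by simp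
    moreover have "int x + int j * int y = int x' + int j * int y'"
      using arg_cong[OF eq[OF ij(2,5)], of int] by simp
    ultimately have "(int i - int j) * (int y - int y') = 0" by (simp add: algebra_simps)
    then have "y = y'" using ij(3) by simp
    then show ?thesis using eq[OF ij(1,4)] by (simp add: xy)
  qed
  have gS: "g ` ?D \<subseteq> PiE {..<k} S"
  proof (clarsimp simp: g_def PiE_iff)
    fix x y i assume "x < d" "y < d" "i < k"
    then show "h i (x + i * y) \<in> S i"
      using bij_betw_apply[OF h[of i], of "x + i * y"] bound[of x y i] by simp
  qed
  have "inj_on g ?D"
  proof (rule inj_onI)
    fix z z' assume "z \<in> ?D" "z' \<in> ?D" "g z = g z'"
    then show "z = z'" using agree[of z z' 0 1] k by simp
  qed
  then have card: "card (g ` ?D) = d ^ 2" by (simp add: card_image power2_eq_square)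
  have "measure_pmf.prob (random_subset A p) {b. \<not> transversal_clique k S (adj_in b)}
    \<le> exp (- (card (g ` ?D) * p ^ (k choose 2)) / 2)"
  proof (rule prob_no_transversal_clique[OF assms(1-5) _ gS])
    fix f assume "f \<in> g ` ?D"
    then obtain z where z: "z \<in> ?D" "f = g z" by blast
    have "\<not> 2 \<le> card {i \<in> {..<k}. f i = f' i}" if f': "f' \<in> g ` ?D" "f' \<noteq> f" for f'
    proof
      assume "2 \<le> card {i \<in> {..<k}. f i = f' i}"
      then obtain I where "I \<subseteq> {i \<in> {..<k}. f i = f' i}" "card I = 2"
        by (rule obtain_subset_with_card_n)
      then obtain i j where "i < k" "j < k" "i \<noteq> j" "f i = f' i" "f j = f' j"
        by (auto simp: card_2_iff)
      then show False using agree[OF z(1)] f' z(2) by blast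
    qed
    then have "{f' \<in> g ` ?D. f' \<noteq> f \<and> 2 \<le> card {i \<in> {..<k}. f i = f' i}} = {}" by blast
    then show "(\<Sum>f'\<in>{f' \<in> g ` ?D. f' \<noteq> f \<and> 2 \<le> card {i \<in> {..<k}. f i = f' i}}.
        p ^ ((k choose 2) - (card {i \<in> {..<k}. f i = f' i} choose 2))) \<le> 1 / 2"
      by (simp only: sum.empty)
  qed simp_all
  then show ?thesis by (simp add: card)
qed

end

lemma prob_not_has_transversals:
  assumes "finite V" "0 \<le> \<beta>"
    and \<beta>: "\<And>S. disjoint_family_on S {..<k} \<Longrightarrow> (\<And>i. i < k \<Longrightarrow> S i \<subseteq> V) \<Longrightarrow>
      (\<And>i. i < k \<Longrightarrow> card (S i) = s) \<Longrightarrow>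
      measure_pmf.prob M {b. \<not> transversal_clique k S (adj_in b)} \<le> \<beta>"
  shows "measure_pmf.prob M {b. \<not> has_transversals k s V (adj_in b)}
    \<le> real ((card V choose s) ^ k) * \<beta>"
proof -
  define T where "T = {S \<in> PiE {..<k} (\<lambda>_. {X. X \<subseteq> V \<and> card X = s}). disjoint_family_on S {..<k}}"
  have fin: "finite (PiE {..<k} (\<lambda>_. {X. X \<subseteq> V \<and> card X = s}))"
    using assms(1) by (intro finite_PiE) auto
  then have finT: "finite T" by (simp add: T_def)
  have "card T \<le> card (PiE {..<k} (\<lambda>_. {X. X \<subseteq> V \<and> card X = s}))"
    using fin by (intro card_mono) (auto simp: T_def)
  also have "\<dots> = (card V choose s) ^ k" using assms(1) by (simp add: card_PiE n_subsets)
  finally have cT: "card T \<le> (card V choose s) ^ k" .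
  have "measure_pmf.prob M {b. \<not> has_transversals k s V (adj_in b)} \<le>
    measure_pmf.prob M (\<Union>S\<in>T. {b. \<not> transversal_clique k S (adj_in b)})"
  proof (rule measure_pmf.finite_measure_mono)
    show "{b. \<not> has_transversals k s V (adj_in b)} \<subseteq>
        (\<Union>S\<in>T. {b. \<not> transversal_clique k S (adj_in b)})"
    proof
      fix b assume "b \<in> {b. \<not> has_transversals k s V (adj_in b)}"
      then obtain S where S: "\<forall>i<k. S i \<subseteq> V \<and> card (S i) = s" "disjoint_family_on S {..<k}"
        "\<not> transversal_clique k S (adj_in b)"
        unfolding has_transversals_def transversal_clique_def by blast
      \<comment> \<open>The values of \<open>S\<close> from \<open>k\<close> on are arbitrary;
        restricting makes the index set of the union finite.\<close>
      have "restrict S {..<k} \<in> T"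
        using S(1,2) by (auto simp: T_def disjoint_family_on_def)
      moreover have "\<not> transversal_clique k (restrict S {..<k}) (adj_in b)"
        using S(3) unfolding transversal_clique_def by auto
      ultimately show "b \<in> (\<Union>S\<in>T. {b. \<not> transversal_clique k S (adj_in b)})" by blast
    qed
  qed simp
  also have "\<dots> \<le> (\<Sum>S\<in>T. measure_pmf.prob M {b. \<not> transversal_clique k S (adj_in b)})"
    using finT by (intro measure_pmf.finite_measure_subadditive_finite) auto
  also have "\<dots> \<le> (\<Sum>S\<in>T. \<beta>)"
  proof (rule sum_mono)
    fix S assume "S \<in> T"
    then show "measure_pmf.prob M {b. \<not> transversal_clique k S (adj_in b)} \<le> \<beta>"
      by (intro \<beta>) (auto simp: T_def PiE_iff)
  qed
  also have "\<dots> = card T * \<beta>" by simp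
  also have "\<dots> \<le> real ((card V choose s) ^ k) * \<beta>"
    using cT assms(2) by (intro mult_right_mono) (simp_all del: of_nat_power)
  finally show ?thesis .
qed

section \<open>Vertices of low degree into a set\<close>

text \<open>Summing the degrees over \<open>E\<close> counts the present pairs between
  \<open>E\<close> and \<open>Q\<close>, each once because the two sets are disjoint. Low degrees
  push this count down to a quarter of its mean, so \<open>prob_few_present\<close> applies.\<close>

lemma prob_low_degrees_fixed:
  fixes p a :: real
  assumes "finite A" "0 \<le> p" "p \<le> 1"
    and V: "all_pairs V \<subseteq> A" "finite V"
    and QE: "Q \<subseteq> V" "E \<subseteq> V" "Q \<inter> E = {}"
  shows "measure_pmf.prob (random_subset A p)
      {b. \<forall>v\<in>E. real (card {q \<in> Q. adj_in b v q}) \<le> p * card Q / 4}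
    \<le> exp (- (p * card E * card Q / 4))"
proof -
  define h where "h = (\<lambda>(v, q). {v, q} :: 'a set)"
  let ?F = "h ` (E \<times> Q)"
  have fin: "finite Q" "finite E" using V(2) QE by (auto intro: finite_subset)
  have inj: "inj_on h (E \<times> Q)"
    using QE(3) by (auto simp: inj_on_def h_def doubleton_eq_iff)
  have cF: "card ?F = card E * card Q" using inj by (simp add: card_image card_cartesian_product)
  have "?F \<subseteq> all_pairs V"
  proof
    fix e assume "e \<in> ?F"
    then obtain v q where "e = {v, q}" "v \<in> E" "q \<in> Q" by (auto simp: h_def)
    then show "e \<in> all_pairs V" using QE by (auto intro!: doubleton_in_all_pairs)
  qed
  then have FA: "?F \<subseteq> A" using V(1) by blast
  have present: "{e \<in> ?F. b e} = h ` (SIGMA v:E. {q \<in> Q. adj_in b v q})" for b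
    using QE(3) by (auto simp: h_def adj_in_def image_iff)
  have card: "card {e \<in> ?F. b e} = (\<Sum>v\<in>E. card {q \<in> Q. adj_in b v q})" for b
  proof -
    have "inj_on h (SIGMA v:E. {q \<in> Q. adj_in b v q})"
      by (rule inj_on_subset[OF inj]) auto
    then have "card {e \<in> ?F. b e} = card (SIGMA v:E. {q \<in> Q. adj_in b v q})"
      unfolding present by (rule card_image)
    then show ?thesis using fin by (simp add: card_SigmaI)
  qed
  have "measure_pmf.prob (random_subset A p)
      {b. \<forall>v\<in>E. real (card {q \<in> Q. adj_in b v q}) \<le> p * card Q / 4}
    \<le> measure_pmf.prob (random_subset A p)
      {b. real (card {e \<in> ?F. b e}) \<le> p * card E * card Q / 4}"
  proof (rule measure_pmf.finite_measure_mono)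
    show "{b. \<forall>v\<in>E. real (card {q \<in> Q. adj_in b v q}) \<le> p * card Q / 4}
      \<subseteq> {b. real (card {e \<in> ?F. b e}) \<le> p * card E * card Q / 4}"
    proof (intro subsetI CollectI)
      fix b assume "b \<in> {b. \<forall>v\<in>E. real (card {q \<in> Q. adj_in b v q}) \<le> p * card Q / 4}"
      then have "(\<Sum>v\<in>E. real (card {q \<in> Q. adj_in b v q})) \<le> (\<Sum>v\<in>E. p * card Q / 4)"
        by (intro sum_mono) simp
      then show "real (card {e \<in> ?F. b e}) \<le> p * card E * card Q / 4"
        unfolding card by (simp add: mult_ac)
    qed
  qed simp
  also have "\<dots> \<le> exp (p * card E * card Q / 4 - p * card ?F / 2)"
    by (rule prob_few_present[OF assms(1) FA assms(2,3)])
  also have "p * card E * card Q / 4 - p * card ?F / 2 = - (p * card E * card Q / 4)"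
    by (simp add: cF)
  finally show ?thesis .
qed

text \<open>A union bound over at most \<open>4 ^ card V\<close> pairs of subsets.\<close>

lemma prob_low_degrees:
  fixes p :: real and V :: "'a set"
  assumes "finite A" "0 \<le> p" "p \<le> 1"
    and V: "all_pairs V \<subseteq> A" "finite V"
  shows "measure_pmf.prob (random_subset A p)
      {b. \<exists>Q E. Q \<subseteq> V \<and> E \<subseteq> V \<and> Q \<inter> E = {} \<and> card Q = d \<and> card E = k \<and>
        (\<forall>v\<in>E. real (card {q \<in> Q. adj_in b v q}) \<le> p * d / 4)}
    \<le> 4 ^ card V * exp (- (p * k * d / 4))"
proof -
  define T where "T = {(Q, E). Q \<subseteq> V \<and> E \<subseteq> V \<and> Q \<inter> E = {} \<and> card Q = d \<and> card E = k}"
  define B where "B = (\<lambda>(Q :: 'a set, E :: 'a set). {b. \<forall>v\<in>E. real (card {q \<in> Q. adj_in b v q}) \<le> p * d / 4})"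
  have sub: "T \<subseteq> Pow V \<times> Pow V" by (auto simp: T_def)
  have finT: "finite T" by (rule finite_subset[OF sub]) (simp add: V)
  have "card T \<le> card (Pow V \<times> Pow V)" by (rule card_mono[OF _ sub]) (simp add: V)
  also have "\<dots> = 2 ^ card V * 2 ^ card V" using V(2) by (simp add: card_cartesian_product card_Pow)
  also have "\<dots> = 4 ^ card V" by (simp add: power_mult_distrib[symmetric])
  finally have "real (card T) \<le> real (4 ^ card V)" by (rule of_nat_mono)
  then have cT: "real (card T) \<le> 4 ^ card V" by simp
  have "{b. \<exists>Q E. Q \<subseteq> V \<and> E \<subseteq> V \<and> Q \<inter> E = {} \<and> card Q = d \<and> card E = k \<and>
        (\<forall>v\<in>E. real (card {q \<in> Q. adj_in b v q}) \<le> p * d / 4)} = (\<Union>z\<in>T. B z)"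
    by (auto simp: T_def B_def)
  then have "measure_pmf.prob (random_subset A p)
      {b. \<exists>Q E. Q \<subseteq> V \<and> E \<subseteq> V \<and> Q \<inter> E = {} \<and> card Q = d \<and> card E = k \<and>
        (\<forall>v\<in>E. real (card {q \<in> Q. adj_in b v q}) \<le> p * d / 4)} =
      measure_pmf.prob (random_subset A p) (\<Union>z\<in>T. B z)" by simp
  also have "\<dots> \<le> (\<Sum>z\<in>T. measure_pmf.prob (random_subset A p) (B z))"
    using finT by (intro measure_pmf.finite_measure_subadditive_finite) auto
  also have "\<dots> \<le> (\<Sum>z\<in>T. exp (- (p * k * d / 4)))"
  proof (rule sum_mono)
    fix z assume z: "z \<in> T"
    obtain Q E where QE: "z = (Q, E)" by force
    have "Q \<subseteq> V" "E \<subseteq> V" "Q \<inter> E = {}" "card Q = d" "card E = k"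
      using z unfolding QE T_def by auto
    then show "measure_pmf.prob (random_subset A p) (B z) \<le> exp (- (p * k * d / 4))"
      using prob_low_degrees_fixed[OF assms, of Q E] unfolding QE B_def by simp
  qed
  also have "\<dots> = card T * exp (- (p * k * d / 4))" by simp
  also have "\<dots> \<le> 4 ^ card V * exp (- (p * k * d / 4))" using cT by (intro mult_right_mono) auto
  finally show ?thesis .
qed

section \<open>From colourings to the arrow relation\<close>

text \<open>A colouring without the two copies restricts to an instance of
  \<open>two_coloured\<close> on \<open>V\<close>. A proper subset \<open>V\<close> is allowed
  because \<open>t\<close> is bounded only from below, while the union bounds require few
  vertices.\<close>

lemma arrows_complete_pathI:
  fixes V :: "nat set"
  assumes "V \<subseteq> {..<N}"
    and contra: "\<And>red blue. two_coloured V red blue n r \<Longrightarrow>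
      two_coloured.adj red blue = adj_in b \<Longrightarrow> False"
  shows "arrows ({..<N}, {e \<in> all_pairs {..<N}. b e}) (complete_graph (r + 1)) (path_graph n)"
  unfolding arrows_def
proof (intro allI, rule ccontr)
  let ?G = "({..<N}, {e \<in> all_pairs {..<N}. b e})"
  fix c
  assume no: "\<not> (contains_copy (colour_class ?G c Red) (complete_graph (r + 1)) \<or>
      contains_copy (colour_class ?G c Blue) (path_graph n))"
  define col where "col x u v \<longleftrightarrow> u \<noteq> v \<and> b {u, v} \<and> c {u, v} = x" for x u v
  have sym: "symp (col x)" for x by (auto simp: symp_def col_def insert_commute)
  have edge: "{u, v} \<in> edges (colour_class ?G c x)" if "col x u v" "u \<in> V" "v \<in> V" for x u v
    using that assms(1) by (auto simp: colour_class_def col_def intro!: doubleton_in_all_pairs)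
  interpret two_coloured V "col Red" "col Blue" n r
  proof
    show "finite V" using assms(1) by (rule finite_subset) simp
    show "symp (col Red)" "symp (col Blue)" by (rule sym)+
  next
    fix xs assume xs: "set xs \<subseteq> V" "distinct xs" "successively (col Blue) xs"
    show "length xs \<le> n"
    proof (rule ccontr)
      assume "\<not> length xs \<le> n"
      then have len: "n < length xs" by simp
      have "contains_copy (colour_class ?G c Blue) (path_graph n)"
        unfolding contains_copy_def path_graph_def
      proof (intro exI[of _ "(!) xs"] conjI)
        show "inj_on ((!) xs) (verts ({..n}, {{i, Suc i} |i. i < n}))"
          using xs(2) len by (auto simp: inj_on_def nth_eq_iff_index_eq)
        have "xs ! i \<in> {..<N}" if "i \<le> n" for i
        proof -
          have "xs ! i \<in> set xs" using that len by simp
          then show ?thesis using xs(1) assms(1) by blast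
        qed
        then show "(!) xs ` verts ({..n}, {{i, Suc i} |i. i < n}) \<subseteq> verts (colour_class ?G c Blue)"
          by (auto simp: colour_class_def)
        have "{xs ! i, xs ! Suc i} \<in> edges (colour_class ?G c Blue)" if "i < n" for i
        proof (rule edge)
          show "col Blue (xs ! i) (xs ! Suc i)"
            using xs(3) that len by (simp add: successively_conv_nth)
          show "xs ! i \<in> V" "xs ! Suc i \<in> V" using xs(1) that len by (auto dest: nth_mem)
        qed
        then show "\<forall>e\<in>edges ({..n}, {{i, Suc i} |i. i < n}).
            (!) xs ` e \<in> edges (colour_class ?G c Blue)"
          by auto
      qed
      then show False using no by blast
    qed
  next
    fix f assume f: "\<And>i. i < Suc r \<Longrightarrow> f i \<in> V"
      "\<And>i j. i < Suc r \<Longrightarrow> j < Suc r \<Longrightarrow> i \<noteq> j \<Longrightarrow> col Red (f i) (f j)"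
    have "contains_copy (colour_class ?G c Red) (complete_graph (r + 1))"
      unfolding contains_copy_def complete_graph_def
    proof (intro exI[of _ f] conjI ballI)
      show "inj_on f (verts ({..<r + 1}, all_pairs {..<r + 1}))"
      proof (rule inj_onI, rule ccontr)
        fix i j assume "i \<in> verts ({..<r + 1}, all_pairs {..<r + 1})"
          "j \<in> verts ({..<r + 1}, all_pairs {..<r + 1})" "f i = f j" "i \<noteq> j"
        then show False using f(2)[of i j] by (simp add: col_def)
      qed
      show "f ` verts ({..<r + 1}, all_pairs {..<r + 1}) \<subseteq> verts (colour_class ?G c Red)"
        using f(1) assms(1) by (auto simp: colour_class_def)
      fix e assume "e \<in> edges ({..<r + 1}, all_pairs {..<r + 1})"
      then obtain i j where "e = {i, j}" "i < Suc r" "j < Suc r" "i \<noteq> j"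
        by (auto simp: all_pairs_def card_2_iff)
      then show "f ` e \<in> edges (colour_class ?G c Red)"
        using edge[of Red "f i" "f j"] f by simp
    qed
    then show False using no by blast
  qed
  have "adj = adj_in b"
    unfolding fun_eq_iff adj_def adj_in_def col_def by (metis colour.exhaust)
  then show False using contra two_coloured_axioms by blast
qed

text \<open>\<open>X\<close> is a property of the random graph alone that rules out every bad
  colouring at once, so colourings never enter a union bound.\<close>

lemma prob_arrows_ge:
  fixes p \<delta> :: real
  assumes "V \<subseteq> {..<N}"
    and bad: "measure_pmf.prob (random_subset (all_pairs {..<N}) p) {b. \<not> X b} \<le> \<delta>"
    and contra: "\<And>b red blue. X b \<Longrightarrow> two_coloured V red blue n r \<Longrightarrow>
      two_coloured.adj red blue = adj_in b \<Longrightarrow> False"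
  shows "measure_pmf.prob (random_graph N p)
    {G. arrows G (complete_graph (r + 1)) (path_graph n)} \<ge> 1 - \<delta>"
proof -
  let ?M = "random_subset (all_pairs {..<N}) p"
  have "1 - \<delta> \<le> 1 - measure_pmf.prob ?M {b. \<not> X b}" using bad by simp
  also have "\<dots> = measure_pmf.prob ?M {b. X b}"
    using measure_pmf.prob_compl[of "{b. X b}" ?M] by (simp add: Collect_neg_eq Compl_eq_Diff_UNIV)
  also have "\<dots> \<le> measure_pmf.prob ?M {b. arrows ({..<N}, {e \<in> all_pairs {..<N}. b e})
      (complete_graph (r + 1)) (path_graph n)}"
  proof (rule measure_pmf.finite_measure_mono)
    show "{b. X b} \<subseteq> {b. arrows ({..<N}, {e \<in> all_pairs {..<N}. b e})
      (complete_graph (r + 1)) (path_graph n)}"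
      by (intro subsetI CollectI arrows_complete_pathI[OF assms(1)]) (rule contra, auto)
  qed simp
  finally show ?thesis unfolding random_graph_def by (simp add: vimage_def)
qed

lemma prob_arrows_sparse:
  fixes p :: real
  assumes p: "0 \<le> p" "p \<le> 1" and t: "t0 \<le> t" "Suc r * s \<le> t0"
    and small: "\<And>j. 2 \<le> j \<Longrightarrow> j < Suc r \<Longrightarrow>
      2 ^ Suc r * (real s ^ (Suc r - j) * p ^ ((Suc r choose 2) - (j choose 2))) \<le> 1 / 2"
  shows "measure_pmf.prob (random_graph (r * n + t) p)
      {G. arrows G (complete_graph (r + 1)) (path_graph n)}
    \<ge> 1 - real (((r * n + t0) choose s) ^ Suc r) * exp (- (real s ^ Suc r * p ^ (Suc r choose 2)) / 2)"
proof -
  let ?V = "{..<r * n + t0}" and ?A = "all_pairs {..<r * n + t}"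
  have VA: "all_pairs ?V \<subseteq> ?A" using t by (intro all_pairs_mono) auto
  have "measure_pmf.prob (random_subset ?A p) {b. \<not> has_transversals (Suc r) s ?V (adj_in b)}
    \<le> real ((card ?V choose s) ^ Suc r) * exp (- (real s ^ Suc r * p ^ (Suc r choose 2)) / 2)"
    by (rule prob_not_has_transversals, simp, simp, rule prob_no_transversal_clique_all)
       (use p VA small in \<open>auto simp: finite_all_pairs\<close>)
  then have bad: "measure_pmf.prob (random_subset ?A p) {b. \<not> has_transversals (Suc r) s ?V (adj_in b)}
    \<le> real (((r * n + t0) choose s) ^ Suc r) * exp (- (real s ^ Suc r * p ^ (Suc r choose 2)) / 2)"
    by (simp only: card_lessThan)
  show ?thesis
  proof (rule prob_arrows_ge[OF _ bad])
    show "?V \<subseteq> {..<r * n + t}" using t by auto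
    fix b red blue
    assume "has_transversals (Suc r) s ?V (adj_in b)" "two_coloured ?V red blue n r"
      "two_coloured.adj red blue = adj_in b"
    then show False using two_coloured.contradiction_sparse[of ?V red blue n r s t0] t(2) by simp
  qed
qed

text \<open>Two failure probabilities are added: some family of \<open>m\<close>-sets has no
  transversal clique, or some \<open>k\<close> vertices all have low degree into a set of
  \<open>n div 4\<close> vertices. The progressions require \<open>m\<close> to be a multiple of
  \<open>Suc r\<close>.\<close>

lemma prob_arrows_dense:
  fixes p :: real
  assumes p: "0 \<le> p" "p \<le> 1" and t: "t0 \<le> t" "r * k < t0" and r: "2 \<le> r"
    and m: "m = Suc r * d" "8 * (Suc r * m) \<le> n" "real ((r + 4) * m + 1) \<le> p * real (n div 4) / 4"
  shows "measure_pmf.prob (random_graph (r * n + t) p)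
      {G. arrows G (complete_graph (r + 1)) (path_graph n)}
    \<ge> 1 - (real (((r * n + t0) choose m) ^ Suc r) * exp (- (real d ^ 2 * p ^ (Suc r choose 2)) / 2)
       + 4 ^ (r * n + t0) * exp (- (p * k * real (n div 4) / 4)))"
proof -
  let ?V = "{..<r * n + t0}" and ?A = "all_pairs {..<r * n + t}"
  define low where "low b \<longleftrightarrow> (\<exists>Q E. Q \<subseteq> ?V \<and> E \<subseteq> ?V \<and> Q \<inter> E = {} \<and> card Q = n div 4 \<and> card E = k \<and>
        (\<forall>v\<in>E. real (card {q \<in> Q. adj_in b v q}) \<le> p * real (n div 4) / 4))"
    for b :: "nat set \<Rightarrow> bool"
  define X where "X b \<longleftrightarrow> has_transversals (Suc r) m ?V (adj_in b) \<and> \<not> low b" for b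
  have VA: "all_pairs ?V \<subseteq> ?A" using t by (intro all_pairs_mono) auto
  have 1: "measure_pmf.prob (random_subset ?A p) {b. \<not> has_transversals (Suc r) m ?V (adj_in b)}
    \<le> real ((card ?V choose m) ^ Suc r) * exp (- (real d ^ 2 * p ^ (Suc r choose 2)) / 2)"
    by (rule prob_not_has_transversals, simp, simp, rule prob_no_transversal_clique_progressions)
       (use p VA r m in \<open>auto simp: finite_all_pairs\<close>)
  have 2: "measure_pmf.prob (random_subset ?A p) {b. low b}
    \<le> 4 ^ card ?V * exp (- (p * k * real (n div 4) / 4))"
    unfolding low_def by (rule prob_low_degrees) (use p VA in \<open>auto simp: finite_all_pairs\<close>)
  have "measure_pmf.prob (random_subset ?A p) {b. \<not> X b} \<le>
    measure_pmf.prob (random_subset ?A p)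
      ({b. \<not> has_transversals (Suc r) m ?V (adj_in b)} \<union> {b. low b})"
    by (rule measure_pmf.finite_measure_mono) (auto simp: X_def)
  also have "\<dots> \<le> measure_pmf.prob (random_subset ?A p) {b. \<not> has_transversals (Suc r) m ?V (adj_in b)}
      + measure_pmf.prob (random_subset ?A p) {b. low b}"
    by (rule measure_Un_le) auto
  finally have bad: "measure_pmf.prob (random_subset ?A p) {b. \<not> X b} \<le>
     real (((r * n + t0) choose m) ^ Suc r) * exp (- (real d ^ 2 * p ^ (Suc r choose 2)) / 2)
       + 4 ^ (r * n + t0) * exp (- (p * k * real (n div 4) / 4))"
    using 1 2 by (simp only: card_lessThan)
  show ?thesis
  proof (rule prob_arrows_ge[OF _ bad])
    show "?V \<subseteq> {..<r * n + t}" using t by auto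
    fix b red blue
    assume X: "X b" and tc: "two_coloured ?V red blue n r"
      and adj: "two_coloured.adj red blue = adj_in b"
    \<comment> \<open>A natural number above the real degree bound is at least its ceiling.\<close>
    define D where "D = nat \<lceil>p * real (n div 4) / 4\<rceil>"
    show False
    proof (rule two_coloured.contradiction_dense[OF tc, of m t0 k D])
      show "has_transversals (Suc r) m ?V (two_coloured.adj red blue)"
        using X by (simp add: X_def adj)
      show "card ?V = r * n + t0" by simp
      show "r * k < t0" "0 < r" "8 * (Suc r * m) \<le> n" using t r m by auto
      have "real ((r + 4) * m + 1) \<le> real D" using m(3) unfolding D_def by linarith
      then show "(r + 4) * m + 1 \<le> D" by (simp only: of_nat_le_iff)
      fix Q E assume QE: "Q \<subseteq> ?V" "E \<subseteq> ?V" "Q \<inter> E = {}" "card Q = n div 4" "card E = k"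
      then have "\<exists>v\<in>E. \<not> real (card {q \<in> Q. adj_in b v q}) \<le> p * real (n div 4) / 4"
        using X unfolding X_def low_def by blast
      then obtain v where "v \<in> E" "p * real (n div 4) / 4 < real (card {q \<in> Q. adj_in b v q})"
        by (auto simp: not_le)
      then show "\<exists>v\<in>E. D \<le> card {q \<in> Q. two_coloured.adj red blue v q}"
        unfolding adj D_def by (intro bexI[of _ v]) linarith+
    qed
  qed
qed

section \<open>Binomial estimates and the exponents for small \<open>p\<close>\<close>

text \<open>The left side divided by \<open>fact s\<close> is a single term of the exponential
  series.\<close>

lemma power_le_exp_fact: "real s ^ s \<le> exp (real s) * fact s"
proof -
  have "(\<Sum>n\<in>{s}. real s ^ n /\<^sub>R fact n) \<le> (\<Sum>n. real s ^ n /\<^sub>R fact n)"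
    by (rule sum_le_suminf[OF summable_exp_generic]) auto
  then have "real s ^ s / fact s \<le> exp (real s)" by (simp add: exp_def divide_inverse mult.commute)
  then show ?thesis by (simp add: field_simps)
qed

text \<open>The estimate \<open>N choose s \<le> (exp 1 * N / s) ^ s\<close>, whose base is at most
  \<open>exp c\<close> by the first assumption.\<close>

lemma choose_le_exp:
  assumes "exp 1 * real N \<le> real s * exp c" "0 < s"
  shows "real (N choose s) \<le> exp (real s * c)"
proof -
  have "real ((N choose s) * fact s) \<le> real (N ^ s)"
    using binomial_fact_pow by (rule of_nat_mono)
  then have "real (N choose s) * fact s \<le> real N ^ s" by simp
  then have "real (N choose s) * real s ^ s \<le> real N ^ s * exp (real s)"
  proof -
    assume *: "real (N choose s) * fact s \<le> real N ^ s"
    have "real (N choose s) * real s ^ s \<le> real (N choose s) * (exp (real s) * fact s)"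
      by (intro mult_left_mono power_le_exp_fact) simp
    also have "\<dots> = (real (N choose s) * fact s) * exp (real s)" by simp
    also have "\<dots> \<le> real N ^ s * exp (real s)" using * by (intro mult_right_mono) auto
    finally show ?thesis .
  qed
  also have "\<dots> = (exp 1 * real N) ^ s"
    by (simp add: power_mult_distrib exp_of_nat_mult[symmetric] mult.commute)
  also have "\<dots> \<le> (real s * exp c) ^ s" using assms(1) by (intro power_mono) auto
  also have "\<dots> = exp (real s * c) * real s ^ s"
    by (simp add: power_mult_distrib exp_of_nat_mult[symmetric] mult.commute)
  finally show ?thesis using assms(2) by simp
qed

lemma double_choose_two: "2 * (n choose 2) = n * (n - 1)"
proof (induction n)
  case (Suc n)
  then show ?case by (cases n) (auto simp: numeral_2_eq_2 algebra_simps)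
qed simp

text \<open>The factor \<open>k - j\<close> turns the dependency terms of the small \<open>p\<close>
  case into powers with exponent \<open>k - j\<close>.\<close>

lemma choose_two_diff:
  assumes "j \<le> k" "1 \<le> k"
  shows "2 * ((k choose 2) - (j choose 2)) = (k - j) * (k + j - 1)"
proof -
  obtain d where d: "k = j + d" using assms(1) le_iff_add by blast
  have "k * (k - 1) = j * (j - 1) + (k - j) * (k + j - 1)"
    unfolding d by (cases j) (auto simp: algebra_simps)
  then show ?thesis by (simp only: diff_mult_distrib2 double_choose_two) simp
qed

text \<open>\<open>q\<close> stands for \<open>sqrt p\<close>, \<open>L\<close> for
  \<open>ln x\<close> and \<open>k\<close> for \<open>r + 1\<close>. The expected number of
  transversal cliques is \<open>s * (s * q ^ k) ^ (k - 1)\<close>, at least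
  \<open>s * (L / (2 * k)) ^ 2\<close> because \<open>3 \<le> k\<close>. The choice of the sets
  costs only \<open>s * k ^ 2 * L / 2\<close> in the exponent, and \<open>8 * k ^ 4 \<le> L\<close>
  makes the expectation at least four times that.\<close>

lemma sparse_failure:
  fixes q L :: real and s k N :: nat
  assumes q: "0 < q" "q \<le> 1" and k: "3 \<le> k" and L: "8 * real k ^ 4 \<le> L" "2 ^ k * (L * q) \<le> 1 / 2"
    and s: "L / (2 * real k) \<le> real s * q ^ k" "real s * q ^ k \<le> L"
    and N: "exp 1 * real N \<le> real s * exp (real k * L / 2)"
  shows "\<And>j. 2 \<le> j \<Longrightarrow> j < k \<Longrightarrow>
      2 ^ k * (real s ^ (k - j) * (q ^ 2) ^ ((k choose 2) - (j choose 2))) \<le> 1 / 2"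
    and "real ((N choose s) ^ k) * exp (- (real s ^ k * (q ^ 2) ^ (k choose 2)) / 2) \<le> exp (- L)"
proof -
  have kr: "1 \<le> real k" using k by simp
  have "1 \<le> real k ^ 4" using kr by (rule one_le_power)
  then have L8: "8 \<le> L" using L(1) by linarith
  have Lq: "0 < L * q" using L8 q by simp
  have "(1::real) \<le> 2 ^ k" by simp
  then have "1 * (L * q) \<le> 2 ^ k * (L * q)" using Lq by (intro mult_right_mono) auto
  then have Lq1: "L * q \<le> 1" using L(2) by linarith
  show "2 ^ k * (real s ^ (k - j) * (q ^ 2) ^ ((k choose 2) - (j choose 2))) \<le> 1 / 2"
    if j: "2 \<le> j" "j < k" for j
  proof -
    have "(q ^ 2) ^ ((k choose 2) - (j choose 2)) = q ^ ((k + j - 1) * (k - j))"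
      using choose_two_diff[of j k] j by (simp add: power_mult[symmetric] mult.commute)
    also have "\<dots> = (q ^ k * q ^ (j - 1)) ^ (k - j)"
      using j by (simp add: power_mult power_add[symmetric])
    finally have "real s ^ (k - j) * (q ^ 2) ^ ((k choose 2) - (j choose 2)) =
        (real s * q ^ k * q ^ (j - 1)) ^ (k - j)" by (simp add: power_mult_distrib)
    also have "\<dots> \<le> (L * q) ^ (k - j)"
    proof (rule power_mono)
      \<comment> \<open>\<open>2 \<le> j\<close> leaves a spare factor \<open>q\<close>, which
        outweighs \<open>L\<close>.\<close>
      have "q ^ (j - 1) \<le> q ^ 1" using q j by (intro power_decreasing) auto
      then show "real s * q ^ k * q ^ (j - 1) \<le> L * q" using s(2) q L8 by (intro mult_mono) auto
      show "0 \<le> real s * q ^ k * q ^ (j - 1)" using q by simp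
    qed
    also have "\<dots> \<le> (L * q) ^ 1" using Lq Lq1 j by (intro power_decreasing) auto
    finally have "2 ^ k * (real s ^ (k - j) * (q ^ 2) ^ ((k choose 2) - (j choose 2))) \<le> 2 ^ k * (L * q)"
      by (intro mult_left_mono) auto
    then show ?thesis using L(2) by linarith
  qed
  have "0 < L / (2 * real k)" using L8 kr by simp
  then have s0: "0 < s" using s(1) q by (cases s) auto
  have "real (N choose s) ^ k \<le> exp (real s * (real k * L / 2)) ^ k"
    using choose_le_exp[OF N s0] by (simp add: power_mono)
  then have ch: "real ((N choose s) ^ k) \<le> exp (real s * real k ^ 2 * L / 2)"
    by (simp add: exp_of_nat_mult[symmetric] power2_eq_square mult_ac)
  have sk: "real s ^ k = real s * real s ^ (k - 1)" using k by (cases k) auto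
  have L2k: "1 \<le> L / (2 * real k)"
  proof -
    have "real k \<le> real k ^ 4" by (rule self_le_power[OF kr]) simp
    then have "2 * real k \<le> L" using L(1) kr by linarith
    then show ?thesis using kr by (simp add: field_simps)
  qed
  have "real s * (real k ^ 2 * L * 2) \<le> real s * (L / (2 * real k)) ^ 2"
  proof (rule mult_left_mono)
    have "8 * real k ^ 4 * L \<le> L * L" using L(1) L8 by (intro mult_right_mono) auto
    then show "real k ^ 2 * L * 2 \<le> (L / (2 * real k)) ^ 2"
      using kr by (simp add: field_simps power2_eq_square power4_eq_xxxx)
  qed simp
  also have "\<dots> \<le> real s * (L / (2 * real k)) ^ (k - 1)"
    using L2k k by (intro mult_left_mono power_increasing) auto
  also have "\<dots> \<le> real s * (real s * q ^ k) ^ (k - 1)"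
    using s(1) L2k by (intro mult_left_mono power_mono) auto
  also have "\<dots> = real s ^ k * (q ^ 2) ^ (k choose 2)"
    unfolding sk power_mult[symmetric] double_choose_two by (simp add: power_mult_distrib power_mult)
  finally have mu: "real s * (real k ^ 2 * L * 2) \<le> real s ^ k * (q ^ 2) ^ (k choose 2)" .
  have "real ((N choose s) ^ k) * exp (- (real s ^ k * (q ^ 2) ^ (k choose 2)) / 2)
    \<le> exp (real s * real k ^ 2 * L / 2) * exp (- (real s * (real k ^ 2 * L * 2)) / 2)"
    using ch mu by (intro mult_mono) auto
  also have "\<dots> = exp (- (real s * real k ^ 2 / 2 * L))"
    by (simp add: exp_add[symmetric] algebra_simps)
  also have "\<dots> \<le> exp (- (1 * L))"
  proof -
    have "9 \<le> real k ^ 2" using power_mono[of 3 "real k" 2] k by simp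
    then have "1 * 9 \<le> real s * real k ^ 2" using s0 by (intro mult_mono) auto
    then have "1 * L \<le> real s * real k ^ 2 / 2 * L" using L8 by (intro mult_right_mono) auto
    then show ?thesis by simp
  qed
  finally show "real ((N choose s) ^ k) * exp (- (real s ^ k * (q ^ 2) ^ (k choose 2)) / 2) \<le> exp (- L)"
    by simp
qed

section \<open>Asymptotics\<close>

text \<open>\<open>\<sigma>\<close> is the scale in the lower bound on \<open>t\<close>. The last
  bound shows that \<open>\<sigma> * ln x\<close>, even rounded up, stays below \<open>n\<close>, so
  the number of vertices actually used is at most \<open>(r + 1) * n\<close>.\<close>

lemma parameter_bounds:
  fixes n k :: nat and x p :: real
  assumes n: "2 \<le> n" and k: "3 \<le> k" and x: "1 \<le> x"
    and p: "p = x * real n powr (- 2 / real k)" "p \<le> 1"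
  defines "\<sigma> \<equiv> p powr (- real k / 2)"
  shows "0 < p" "\<sigma> = real n * x powr (- real k / 2)" "sqrt p ^ k * \<sigma> = 1" "1 / p \<le> \<sigma>" "1 \<le> \<sigma>"
    "ln x \<le> ln (real n)" "\<sigma> * ln x + 1 \<le> real n"
proof -
  have n0: "0 < real n" using n by simp
  show p0: "0 < p" using p(1) x n0 by simp
  show \<sigma>: "\<sigma> = real n * x powr (- real k / 2)"
    using x n0 k unfolding \<sigma>_def p(1) by (simp add: powr_mult powr_powr)
  have "sqrt p ^ k = p powr (real k / 2)"
    using p0 by (simp add: powr_half_sqrt[symmetric] powr_powr powr_realpow[symmetric])
  then show "sqrt p ^ k * \<sigma> = 1" using p0 by (simp add: \<sigma>_def powr_add[symmetric])
  have "p powr (- 1) \<le> \<sigma>"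
    unfolding \<sigma>_def using p0 p(2) k by (intro powr_mono') auto
  then show p\<sigma>: "1 / p \<le> \<sigma>" using p0 by (simp add: powr_minus_divide)
  have "1 \<le> 1 / p" using p0 p(2) by simp
  then show "1 \<le> \<sigma>" using p\<sigma> by linarith
  have "x = p * real n powr (2 / real k)"
    using n0 unfolding p(1) by (simp add: powr_minus field_simps)
  also have "\<dots> \<le> 1 * real n powr 1"
    using p(2) p0 n k by (intro mult_mono powr_mono) auto
  finally have "x \<le> real n" using n0 by simp
  then show "ln x \<le> ln (real n)" using x by simp
  \<comment> \<open>Splitting off \<open>ln 2\<close> and using \<open>ln y \<le> y - 1\<close> for
    both parts gives the constant \<open>1 / 2\<close>.\<close>
  have "ln x = ln (x / 2) + ln 2" using x by (simp add: ln_div)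
  also have "\<dots> \<le> (x / 2 - 1) + 1"
    using ln_le_minus_one[of "x / 2"] ln_le_minus_one[of "2::real"] x by (intro add_mono) auto
  finally have lnx: "ln x \<le> x / 2" by simp
  have "x powr (- real k / 2) \<le> x powr (- 1)" using x k by (intro powr_mono) auto
  then have "x powr (- real k / 2) * ln x \<le> x powr (- 1) * (x / 2)"
    using x lnx by (intro mult_mono) auto
  also have "\<dots> = 1 / 2" using x by (simp add: powr_minus_divide)
  finally have "real n * (x powr (- real k / 2) * ln x) \<le> real n * (1 / 2)"
    using n0 by (intro mult_left_mono) auto
  then have "\<sigma> * ln x \<le> real n / 2" unfolding \<sigma> by (simp add: mult.assoc)
  then show "\<sigma> * ln x + 1 \<le> real n" using n by simp
qed

text \<open>\<open>t\<close> is cut down to \<open>t0\<close>, the rounded value of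
  \<open>\<sigma> * L\<close>. Then \<open>s = t0 div k\<close> places \<open>s * sqrt p ^ k\<close>
  between \<open>L / (2 * k)\<close> and \<open>L\<close>, and the failure probability is at most
  \<open>exp (- L)\<close>, which is \<open>1 / x\<close>.\<close>

lemma prob_arrows_small_p:
  fixes n r t :: nat and x p :: real
  assumes n: "2 \<le> n" and r: "2 \<le> r" and x: "1 \<le> x" "8 * real (Suc r) ^ 4 \<le> ln x"
    and p: "p = x * real n powr (- 2 / real (Suc r))" "p \<le> 1"
    and t: "p powr (- real (Suc r) / 2) * ln x \<le> real t"
    and small: "2 ^ Suc r * (ln (real n) * sqrt p) \<le> 1 / 2"
  shows "1 - 1 / x \<le> measure_pmf.prob (random_graph (r * n + t) p)
      {G. arrows G (complete_graph (r + 1)) (path_graph n)}"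
proof -
  define k where "k = Suc r"
  define L where "L = ln x"
  define \<sigma> where "\<sigma> = p powr (- real k / 2)"
  have k: "3 \<le> k" using r by (simp add: k_def)
  have x0: "0 < x" using x by simp
  note pb = parameter_bounds[OF n k x(1) p[folded k_def], folded \<sigma>_def L_def]
  have kr: "3 \<le> real k" using k by simp
  have L: "8 * real k ^ 4 \<le> L" using x(2) by (simp add: k_def L_def)
  have k4: "real k ^ 2 \<le> real k ^ 4" "real k \<le> real k ^ 4"
    using kr by (auto intro!: power_increasing self_le_power)
  define t0 where "t0 = nat \<lceil>\<sigma> * L\<rceil>"
  define s where "s = t0 div k"
  have L0: "2 * real k \<le> L" "0 \<le> L" using L k4(2) kr by linarith+
  have \<sigma>L: "L \<le> \<sigma> * L" using pb(5) L0 by (simp add: mult_le_cancel_right1)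
  have t0: "\<sigma> * L \<le> real t0" "real t0 \<le> \<sigma> * L + 1" using L0 \<sigma>L unfolding t0_def by linarith+
  have t0t: "t0 \<le> t" using t unfolding t0_def \<sigma>_def L_def k_def by linarith
  have t0n: "t0 \<le> n" using t0(2) pb(7) by linarith
  have ks: "k * s \<le> t0" "t0 < k * (s + 1)"
    using k unfolding s_def by (auto simp: dividend_less_times_div algebra_simps)
  have "real t0 < real k * (real s + 1)" using of_nat_less_iff[where 'a = real, THEN iffD2, OF ks(2)] by (simp add: algebra_simps)
  then have s_lo: "\<sigma> * L \<le> real s * (2 * real k)" using t0(1) \<sigma>L L0 by (simp add: algebra_simps)
  have "real k * real s \<le> real t0" using of_nat_mono[OF ks(1), where 'a = real] by simp
  moreover have "3 * real s \<le> real k * real s" using kr by (intro mult_right_mono) auto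
  ultimately have s_hi: "real s \<le> \<sigma> * L" using t0(2) \<sigma>L L0 kr by linarith
  have q\<sigma>: "sqrt p ^ k = 1 / \<sigma>" using pb(3,5) by (simp add: field_simps)
  have \<sigma>0: "0 < \<sigma>" using pb(5) by simp
  \<comment> \<open>This identity explains the exponent \<open>k * L / 2\<close>: up to constants
    absorbed by \<open>L\<close>, the ratio of \<open>N = r * n + t0\<close> to \<open>s\<close> is
    at most \<open>n / \<sigma>\<close>.\<close>
  have "exp (real k * L / 2) = x powr (real k / 2)" using x0 by (simp add: powr_def L_def)
  also have "\<dots> = real n / \<sigma>" unfolding pb(2) using x0 n by (simp add: powr_minus field_simps)
  finally have ex: "exp (real k * L / 2) = real n / \<sigma>" .
  have N: "exp 1 * real (r * n + t0) \<le> real s * exp (real k * L / 2)"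
  proof -
    have "r * n + t0 \<le> k * n" using t0n by (simp add: k_def)
    then have "real (r * n + t0) \<le> real k * real n" by (simp only: of_nat_mult[symmetric] of_nat_le_iff)
    then have "exp 1 * real (r * n + t0) \<le> 3 * (real k * real n)"
      using exp_le by (intro mult_mono) auto
    also have "\<dots> \<le> L / (2 * real k) * real n"
    proof -
      have "6 * real k ^ 2 \<le> L" using L k4(1) zero_le_power2[of "real k"] by linarith
      then have "3 * real k \<le> L / (2 * real k)" using kr by (simp add: field_simps power2_eq_square)
      then have "3 * real k * real n \<le> L / (2 * real k) * real n" by (rule mult_right_mono) simp
      then show ?thesis by (simp only: mult.assoc)
    qed
    also have "\<dots> \<le> real s / \<sigma> * real n"
    proof (rule mult_right_mono)
      show "L / (2 * real k) \<le> real s / \<sigma>" using s_lo kr \<sigma>0 by (simp add: field_simps)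
    qed simp
    finally show ?thesis unfolding ex by simp
  qed
  have q: "0 < sqrt p" "sqrt p \<le> 1" using pb(1) p(2) by auto
  have Lq: "2 ^ k * (L * sqrt p) \<le> 1 / 2"
  proof -
    have "L * sqrt p \<le> ln (real n) * sqrt p" using pb(6) q by (intro mult_right_mono) auto
    then have "2 ^ k * (L * sqrt p) \<le> 2 ^ k * (ln (real n) * sqrt p)" by (intro mult_left_mono) auto
    then show ?thesis using small by (simp only: k_def)
  qed
  have s1: "L / (2 * real k) \<le> real s * sqrt p ^ k" unfolding q\<sigma> using s_lo kr \<sigma>0 by (simp add: field_simps)
  have s2: "real s * sqrt p ^ k \<le> L" unfolding q\<sigma> using s_hi \<sigma>0 by (simp add: field_simps)
  have sq: "sqrt p ^ 2 = p" using pb(1) by simp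
  note sf = sparse_failure[OF q k L Lq s1 s2 N, unfolded sq k_def]
  have "1 - exp (- L) \<le> 1 - real (((r * n + t0) choose s) ^ Suc r) * exp (- (real s ^ Suc r * p ^ (Suc r choose 2)) / 2)"
    using sf(2) by linarith
  also have "\<dots> \<le> measure_pmf.prob (random_graph (r * n + t) p)
      {G. arrows G (complete_graph (r + 1)) (path_graph n)}"
    by (rule prob_arrows_sparse) (use pb(1) p(2) t0t ks(1) sf(1) in \<open>auto simp: k_def\<close>)
  finally show ?thesis using x0 by (simp add: L_def exp_minus divide_inverse)
qed

text \<open>With sets of size of order \<open>sqrt n\<close>, \<open>large\<close> keeps
  \<open>p ^ (k choose 2)\<close> above \<open>n powr (- 1 / 8)\<close>. The exponent is then of
  order at least \<open>n powr (7 / 8)\<close> and beats the cost of choosing the sets, of order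
  \<open>sqrt n * ln n\<close>.\<close>

lemma prob_arrows_large_p:
  fixes n r t :: nat and x p :: real
  assumes r: "2 \<le> r" and x: "1 \<le> x" "real r * (64 * real (Suc r) + 33) < ln x"
    and p: "p = x * real n powr (- 2 / real (Suc r))" "p \<le> 1"
    and t: "p powr (- real (Suc r) / 2) * ln x \<le> real t"
    and large: "real n powr (- 1 / (4 * real (Suc r) ^ 2)) \<le> p"
    and n: "64 * real (Suc r) ^ 4 \<le> real n" "96 * real (Suc r) ^ 2 \<le> real n powr (1 / 4)"
      "real (Suc r) ^ 2 * ln (real (Suc r) * real n) + 1 \<le> real n powr (3 / 8) / 4"
  shows "1 - (exp (- (sqrt (real n) / 2)) + exp (- real n)) \<le>
      measure_pmf.prob (random_graph (r * n + t) p)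
      {G. arrows G (complete_graph (r + 1)) (path_graph n)}"
proof -
  define k where "k = Suc r"
  define L where "L = ln x"
  define \<sigma> where "\<sigma> = p powr (- real k / 2)"
  have k: "3 \<le> k" using r by (simp add: k_def)
  have kr: "3 \<le> real k" using k by simp
  note nk = n[folded k_def]
  have "1 \<le> real k ^ 4" using kr by (intro one_le_power) auto
  then have n64: "64 \<le> real n" using nk(1) by linarith
  then have n2: "2 \<le> n" by simp
  note pb = parameter_bounds[OF n2 k x(1) p[folded k_def], folded \<sigma>_def L_def]
  have L: "real r * (64 * real k + 33) < L" using x(2) by (simp add: k_def L_def)
  have L0: "0 \<le> L" using x(1) by (simp add: L_def)
  define t0 where "t0 = nat \<lceil>\<sigma> * L\<rceil>"
  have \<sigma>L: "0 \<le> \<sigma> * L" using pb(5) L0 by simp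
  have t0: "\<sigma> * L \<le> real t0" "real t0 \<le> \<sigma> * L + 1" using \<sigma>L unfolding t0_def by linarith+
  have t0t: "t0 \<le> t" using t unfolding t0_def \<sigma>_def L_def k_def by linarith
  have t0n: "t0 \<le> n" using t0(2) pb(7) by linarith
  define w where "w = sqrt (real n)"
  have w2: "w ^ 2 = real n" by (simp add: w_def)
  have w8: "8 \<le> w" unfolding w_def using n64 by (intro real_le_rsqrt) simp
  define d where "d = nat \<lfloor>w\<rfloor>"
  have d: "w / 2 \<le> real d" "real d \<le> w" using w8 unfolding d_def by linarith+
  \<comment> \<open>\<open>C\<close> satisfies \<open>C * n / 32 = 2 * k * n + n\<close>: the first
    summand cancels the bound \<open>exp (2 * k * n)\<close> for \<open>4 ^ N\<close>, the second
    remains as the error.\<close>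
  define C where "C = 64 * real k + 32"
  define c where "c = nat \<lceil>C / p\<rceil>"
  have C0: "0 \<le> C" by (simp add: C_def)
  have Cp: "0 \<le> C / p" using C0 pb(1) by simp
  have c: "C / p \<le> real c" "real c \<le> C / p + 1" using Cp unfolding c_def by linarith+
  have "real (r * c) < real t0"
  proof -
    \<comment> \<open>Rounding up costs at most \<open>1 / p\<close>, which is why the hypothesis on
      \<open>ln x\<close> has 33 in place of 32.\<close>
    have "real c \<le> (C + 1) * (1 / p)"
    proof -
      have "1 \<le> 1 / p" using pb(1) p(2) by simp
      then show ?thesis using c(2) by (simp add: algebra_simps add_divide_distrib)
    qed
    then have "real r * real c \<le> real r * ((C + 1) * (1 / p))" by (intro mult_left_mono) auto
    also have "\<dots> = real r * (64 * real k + 33) * (1 / p)" by (simp add: C_def)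
    also have "\<dots> < L * (1 / p)" using L pb(1) by (intro mult_strict_right_mono) auto
    also have "\<dots> \<le> L * \<sigma>" using pb(4) L0 by (intro mult_left_mono) auto
    finally show ?thesis using t0(1) by (simp add: mult.commute)
  qed
  then have rc: "r * c < t0" by (simp only: of_nat_less_iff)
  have n4: "real n / 8 \<le> real (n div 4)" using n64 by linarith
  have m_n: "8 * (k * (k * d)) \<le> n"
  proof -
    have "(8 * real k ^ 2) ^ 2 \<le> w ^ 2" using nk(1) unfolding w2 by (simp add: power_mult_distrib)
    then have "8 * real k ^ 2 \<le> w" by (rule power2_le_imp_le) (use w8 in simp)
    then have "8 * real k ^ 2 * real d \<le> w * w" using d w8 by (intro mult_mono) auto
    then have "real (8 * (k * (k * d))) \<le> real n" using w2 by (simp add: power2_eq_square mult_ac)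
    then show ?thesis by (simp only: of_nat_le_iff)
  qed
  have pn: "real n powr (3 / 4) \<le> p * real n"
  proof -
    have "real n powr (3 / 4) = real n powr (- 1 / 4) * real n"
      using n64 powr_add[of "real n" "- 1 / 4" 1] by simp
    also have "\<dots> \<le> real n powr (- 1 / (4 * real k ^ 2)) * real n"
    proof (intro mult_right_mono powr_mono)
      have "1 \<le> real k ^ 2" using kr by (intro one_le_power) auto
      then have "1 / (4 * real k ^ 2) \<le> 1 / 4" using kr by (intro divide_left_mono) auto
      then show "- 1 / 4 \<le> - 1 / (4 * real k ^ 2)" by simp
    qed (use n64 in auto)
    also have "\<dots> \<le> p * real n" using large by (intro mult_right_mono) (auto simp: k_def)
    finally show ?thesis .
  qed
  have m_p: "real ((r + 4) * (k * d) + 1) \<le> p * real (n div 4) / 4"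
  proof -
    have "real ((r + 4) * (k * d) + 1) = (real k + 3) * real k * real d + 1" by (simp add: k_def algebra_simps)
    also have "\<dots> \<le> (real k + real k) * real k * w + real k * real k * w"
    proof (rule add_mono)
      show "(real k + 3) * real k * real d \<le> (real k + real k) * real k * w"
        using kr d w8 by (intro mult_mono add_mono) auto
      have "1 * 1 * 1 \<le> real k * real k * w" using kr w8 by (intro mult_mono) auto
      then show "1 \<le> real k * real k * w" by simp
    qed
    also have "\<dots> = 96 * real k ^ 2 * w / 32" by (simp add: power2_eq_square)
    also have "\<dots> \<le> real n powr (1 / 4) * w / 32" using nk(2) w8 by (intro divide_right_mono mult_right_mono) auto
    also have "real n powr (1 / 4) * w = real n powr (3 / 4)"
      unfolding w_def using n64 by (simp add: powr_half_sqrt[symmetric] powr_add[symmetric])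
    also have "real n powr (3 / 4) / 32 \<le> p * (real n / 8) / 4" using pn by simp
    also have "\<dots> \<le> p * real (n div 4) / 4" using n4 pb(1) by (intro divide_right_mono mult_left_mono) auto
    finally show ?thesis .
  qed
  define N where "N = r * n + t0"
  have "N \<le> k * n" using t0n by (simp add: k_def N_def)
  then have Nkn: "real N \<le> real k * real n" by (simp only: of_nat_mult[symmetric] of_nat_le_iff)
  have d2: "4 ^ N * exp (- (p * c * real (n div 4) / 4)) \<le> exp (- real n)"
  proof -
    have "(4 :: real) \<le> exp 2" using exp_ge_one_plus_x_over_n_power_n[of 2 2] by simp
    then have "(4 :: real) ^ N \<le> exp 2 ^ N" by (intro power_mono) auto
    also have "\<dots> = exp (2 * real N)" by (simp add: exp_of_nat_mult[symmetric] mult.commute)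
    finally have 1: "(4 :: real) ^ N \<le> exp (2 * (real k * real n))"
      using Nkn by (smt (verit) exp_le_cancel_iff)
    have "C \<le> p * real c" using c(1) pb(1) by (simp add: field_simps)
    then have "C * (real n / 8) \<le> p * real c * real (n div 4)"
      using n4 C0 pb(1) by (intro mult_mono) auto
    then have 2: "- (p * c * real (n div 4) / 4) \<le> - (C * real n / 32)" by simp
    have "4 ^ N * exp (- (p * c * real (n div 4) / 4)) \<le>
        exp (2 * (real k * real n)) * exp (- (C * real n / 32))"
      using 1 2 by (intro mult_mono) auto
    also have "\<dots> = exp (- real n)"
      by (simp add: exp_add[symmetric] C_def field_simps)
    finally show ?thesis .
  qed
  have d1: "real ((N choose (k * d)) ^ k) * exp (- (real d ^ 2 * p ^ (k choose 2)) / 2) \<le> exp (- (w / 2))"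
  proof -
    have kn0: "1 \<le> real k * real n" using mult_mono[of 1 "real k" 1 "real n"] kr n64 by simp
    have "N choose (k * d) \<le> N ^ (k * d)"
      by (cases "k * d \<le> N") (auto simp: binomial_le_pow binomial_eq_0)
    then have "(N choose (k * d)) ^ k \<le> (N ^ (k * d)) ^ k" by (intro power_mono) auto
    then have "real ((N choose (k * d)) ^ k) \<le> real N ^ (k * d * k)"
      by (simp only: power_mult[symmetric] of_nat_power[symmetric] of_nat_le_iff)
    also have "\<dots> \<le> (real k * real n) ^ (k * d * k)" using Nkn by (intro power_mono) auto
    also have "\<dots> = exp (ln (real k * real n)) ^ (k * d * k)" using kn0 by simp
    also have "\<dots> = exp (real d * (real k ^ 2 * ln (real k * real n)))"
      unfolding exp_of_nat_mult[symmetric] by (simp add: power2_eq_square mult_ac)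
    finally have 1: "real ((N choose (k * d)) ^ k) \<le> exp (real d * (real k ^ 2 * ln (real k * real n)))" .
    have "real n powr (- 1 / 8) \<le> p ^ (k choose 2)"
    proof -
      \<comment> \<open>As \<open>k choose 2\<close> is at most \<open>k ^ 2 / 2\<close>, the
        exponent \<open>1 / (4 * k ^ 2)\<close> becomes at most \<open>1 / 8\<close>.\<close>
      have "real (2 * (k choose 2)) \<le> real (k * k)" unfolding double_choose_two by (simp add: mult_left_mono)
      then have "real (k choose 2) \<le> real k ^ 2 / 2" by (simp add: power2_eq_square)
      then have "1 / (4 * real k ^ 2) * real (k choose 2) \<le> 1 / (4 * real k ^ 2) * (real k ^ 2 / 2)"
        by (intro mult_left_mono) auto
      then have "- 1 / 8 \<le> - 1 / (4 * real k ^ 2) * real (k choose 2)" using kr by simp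
      then have "real n powr (- 1 / 8) \<le> real n powr (- 1 / (4 * real k ^ 2) * real (k choose 2))"
        using n64 by (intro powr_mono) auto
      also have "\<dots> = (real n powr (- 1 / (4 * real k ^ 2))) ^ (k choose 2)"
        unfolding powr_powr[symmetric] using n64 by (subst powr_realpow) auto
      also have "\<dots> \<le> p ^ (k choose 2)" using large by (intro power_mono) (auto simp: k_def)
      finally show ?thesis .
    qed
    then have "w / 2 * real n powr (- 1 / 8) \<le> real d * p ^ (k choose 2)"
      using d w8 by (intro mult_mono) auto
    moreover have "w * real n powr (- 1 / 8) = real n powr (3 / 8)"
      unfolding w_def using n64 by (simp add: powr_half_sqrt[symmetric] powr_add[symmetric])
    ultimately have "real n powr (3 / 8) / 4 \<le> real d * p ^ (k choose 2) / 2" by simp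
    then have "real k ^ 2 * ln (real k * real n) + 1 \<le> real d * p ^ (k choose 2) / 2" using nk(3) by linarith
    then have "real d * (real k ^ 2 * ln (real k * real n) + 1) \<le> real d * (real d * p ^ (k choose 2) / 2)"
      by (intro mult_left_mono) auto
    then have 2: "- (real d ^ 2 * p ^ (k choose 2)) / 2 \<le> - (real d * (real k ^ 2 * ln (real k * real n))) - real d"
      by (simp add: power2_eq_square algebra_simps)
    have "real ((N choose (k * d)) ^ k) * exp (- (real d ^ 2 * p ^ (k choose 2)) / 2) \<le>
      exp (real d * (real k ^ 2 * ln (real k * real n))) *
      exp (- (real d * (real k ^ 2 * ln (real k * real n))) - real d)"
      using 1 2 by (intro mult_mono) auto
    also have "\<dots> = exp (- real d)" by (simp add: exp_add[symmetric])
    also have "\<dots> \<le> exp (- (w / 2))" using d(1) by simp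
    finally show ?thesis .
  qed
  have "1 - (exp (- (w / 2)) + exp (- real n)) \<le>
    1 - (real (((r * n + t0) choose (k * d)) ^ Suc r) * exp (- (real d ^ 2 * p ^ (Suc r choose 2)) / 2)
       + 4 ^ (r * n + t0) * exp (- (p * c * real (n div 4) / 4)))"
    using d1 d2 unfolding N_def by (simp only: k_def)
  also have "\<dots> \<le> measure_pmf.prob (random_graph (r * n + t) p)
      {G. arrows G (complete_graph (r + 1)) (path_graph n)}"
    by (rule prob_arrows_dense) (use pb(1) p(2) t0t rc r m_n m_p in \<open>simp_all add: k_def\<close>)
  finally show ?thesis by (simp only: w_def)
qed

theorem theorem3p1:
  fixes r :: nat and x p :: "nat \<Rightarrow> real" and t :: "nat \<Rightarrow> nat"
  assumes "r \<ge> 2"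
    and "filterlim x at_top sequentially"
    and "\<And>n. p n = x n * real n powr (- 2 / (real r + 1))"
    and "eventually (\<lambda>n. 0 \<le> p n \<and> p n \<le> 1) sequentially"
    and "eventually (\<lambda>n. real (t n) \<ge> p n powr (- (real r + 1) / 2) * ln (x n)) sequentially"
  shows "(\<lambda>n. measure_pmf.prob (random_graph (r * n + t n) (p n))
            {G. arrows G (complete_graph (r + 1)) (path_graph n)}) \<longlonglongrightarrow> 1"
proof -
  define k where "k = real (Suc r)"
  have k0: "k > 0" by (simp add: k_def)
  \<comment> \<open>The exponent separating the two regimes: above \<open>n powr (- e)\<close> the
    dense argument works, and below it \<open>sqrt p\<close> outweighs \<open>ln n\<close>.\<close>
  define e where "e = 1 / (4 * k ^ 2)"
  have e0: "e > 0" using k0 by (simp add: e_def)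
  let ?P = "\<lambda>n. measure_pmf.prob (random_graph (r * n + t n) (p n))
            {G. arrows G (complete_graph (r + 1)) (path_graph n)}"
  let ?\<delta> = "\<lambda>n. 1 / x n + exp (- (sqrt (real n) / 2)) + exp (- real n)"
  have lnx: "filterlim (\<lambda>n. ln (x n)) at_top sequentially"
    by (rule filterlim_compose[OF ln_at_top assms(2)])
  have "((\<lambda>n::nat. 2 ^ Suc r * (ln (real n) * real n powr (- e / 2))) \<longlongrightarrow> 0) sequentially"
    using e0 by real_asymp
  then have small: "eventually (\<lambda>n::nat. 2 ^ Suc r * (ln (real n) * real n powr (- e / 2)) < 1 / 2) sequentially"
    by (rule order_tendstoD) simp
  have n1: "eventually (\<lambda>n::nat. 64 * k ^ 4 \<le> real n) sequentially"
    using k0 by real_asymp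
  have n2: "eventually (\<lambda>n::nat. 96 * k ^ 2 \<le> real n powr (1 / 4)) sequentially"
    using k0 by real_asymp
  have n3: "eventually (\<lambda>n::nat. k ^ 2 * ln (k * real n) + 1 \<le> real n powr (3 / 8) / 4) sequentially"
    using k0 by real_asymp
  have "eventually (\<lambda>n. 1 - ?\<delta> n \<le> ?P n) sequentially"
    using assms(4,5) small n1 n2 n3 eventually_ge_at_top[of "2::nat"]
      filterlim_at_top[THEN iffD1, OF assms(2), rule_format, of 1]
      filterlim_at_top[THEN iffD1, OF lnx, rule_format, of "8 * k ^ 4"]
      filterlim_at_top_dense[THEN iffD1, OF lnx, rule_format, of "real r * (64 * k + 33)"]
  proof eventually_elim
    case (elim n)
    have p: "p n = x n * real n powr (- 2 / real (Suc r))" using assms(3)[of n] by (simp add: add.commute)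
    have t: "p n powr (- real (Suc r) / 2) * ln (x n) \<le> real (t n)" using elim(2) by (simp add: add.commute)
    have nn: "0 \<le> 1 / x n" "0 \<le> exp (- (sqrt (real n) / 2))" "0 \<le> exp (- real n)"
      using elim by simp_all
    \<comment> \<open>The sequence \<open>p\<close> may change regime infinitely often, so the split
      is made separately for each \<open>n\<close>; \<open>?\<delta>\<close> contains the errors of
      both regimes.\<close>
    show ?case
    proof (cases "real n powr (- e) \<le> p n")
      case True
      have "1 - (exp (- (sqrt (real n) / 2)) + exp (- real n)) \<le> ?P n"
        by (rule prob_arrows_large_p[OF assms(1) _ _ p _ t])
          (use elim True in \<open>simp_all add: k_def e_def\<close>)
      then show ?thesis using nn by linarith
    next
      case False
      have "sqrt (p n) \<le> sqrt (real n powr (- e))" using False by simp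
      also have "\<dots> = real n powr (- e / 2)" by (simp add: powr_half_sqrt[symmetric] powr_powr)
      finally have "sqrt (p n) \<le> real n powr (- e / 2)" .
      then have "ln (real n) * sqrt (p n) \<le> ln (real n) * real n powr (- e / 2)"
        using elim by (intro mult_left_mono) auto
      then have "2 ^ Suc r * (ln (real n) * sqrt (p n)) \<le> 2 ^ Suc r * (ln (real n) * real n powr (- e / 2))"
        by (rule mult_left_mono) simp
      then have "2 ^ Suc r * (ln (real n) * sqrt (p n)) \<le> 1 / 2" using elim(3) by linarith
      then have "1 - 1 / x n \<le> ?P n"
        using elim by (intro prob_arrows_small_p[OF _ assms(1) _ _ p _ t]) (simp_all add: k_def)
      then show ?thesis using nn by linarith
    qed
  qed
  moreover have "(\<lambda>n. 1 - ?\<delta> n) \<longlonglongrightarrow> 1"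
  proof -
    have "(\<lambda>n. 1 / x n) \<longlonglongrightarrow> 0"
      using tendsto_inverse_0_at_top[OF assms(2)] by (simp add: divide_inverse)
    moreover have "(\<lambda>n::nat. exp (- (sqrt (real n) / 2))) \<longlonglongrightarrow> 0" "(\<lambda>n::nat. exp (- real n)) \<longlonglongrightarrow> 0"
      by real_asymp+
    ultimately have "(\<lambda>n. 1 - ?\<delta> n) \<longlonglongrightarrow> 1 - (0 + 0 + 0)" by (intro tendsto_intros)
    then show ?thesis by simp
  qed
  ultimately show ?thesis
    by (intro tendsto_sandwich[where g = ?P and h = "\<lambda>_. 1"]) (auto simp: measure_pmf.prob_le_1)
qed

end
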